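(* Consider the game $\mathsf H$ with one more-informed player, the belief update maps $F_t$ and the min-max dynamic program defined in the context, and let $\Xi_t^1$ be a measurable map giving a min-maximizer in that program at each belief $\pi_t$. Define a strategy $g^{1*}$ for player 1 in $\mathsf H$ by setting, for every $t\le T$, $p_t^1=x_t\in\mathcal X_t$ and $c_t\in\mathcal C_t$, $$g_t^{1*}(p_t^1,c_t)=[\Xi_t^1(\pi_t)](p_t^1),$$ where $\pi_t$ is computed by $\pi_1(x_1)=\mathbb P[X_1=x_1\mid C_1=c_1]$ for all $x_1$, and $\pi_{\tau+1}=F_\tau(\pi_\tau,\Xi_\tau^1(\pi_\tau),z_{\tau+1})$ for $1\le\tau<t$. Then $g^{1*}$ is an equilibrium (minimax) strategy for player 1 in $\mathsf H$, i.e. $\sup_{g^2}J(g^{1*},g^2)=\inf_{g^1}\sup_{g^2}J(g^1,g^2)$ and there is a Nash equilibrium of $\mathsf H$ in which player 1 plays $g^{1*}$.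
   Context: $\Delta\mathcal A$ is the probability simplex over a finite set $\mathcal A$; $X_{a:b}=(X_a,\dots,X_b)$. **Game $\mathsf H$.** Fix a horizon $T$ and finite sets $\mathcal X_t,\mathcal U_t^1,\mathcal U_t^2,\mathcal Y_t^2$. The state evolves as $X_{t+1}=f_t(X_t,U_t^1,U_t^2,W_t^s)$, and player 2 gets the observation $Y_t^2=h_t^2(X_t,U_{t-1}^1,U_{t-1}^2,W_t^2)$ (no action arguments at $t=1$). The random variables $X_1,W_t^s,W_t^2$ take finitely many values and are mutually independent. Objects indexed by $T+1$ are defined by the same equations. The common information is $C_t=\{Y_{1:t}^2,U_{1:t-1}^2\}$ (realization set $\mathcal C_t$), with increments $Z_{t+1}=(Y_{t+1}^2,U_t^2)$. At time $t$ player 1 knows $C_t$ and its private information $P_t^1=X_t$; player 2 knows only $C_t$. Behavioral strategies are $g^1=(g_t^1)_{t\le T}$, $g_t^1:\mathcal X_t\times\mathcal C_t\to\Delta\mathcal U_t^1$, and $g^2=(g_t^2)_{t\le T}$, $g_t^2:\mathcal C_t\to\Delta\mathcal U_t^2$; actions are drawn from $g_t^1(X_t,C_t)$ and $g_t^2(C_t)$ using randomizations independent across players and time and independent of $X_1,W_t^s,W_t^2$. The cost is $J(g^1,g^2)=\mathbb E^{(g^1,g^2)}[\sum_{t=1}^Tc_t(X_t,U_t^1,U_t^2)]$ with $c_t:\mathcal X_t\times\mathcal U_t^1\times\mathcal U_t^2\to\mathbb R$; player 1 minimizes, player 2 maximizes. A Nash equilibrium is $(g^{1*},g^{2*})$ with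 $J(g^{1*},g^2)\le J(g^{1*},g^{2*})\le J(g^1,g^{2*})$ for all $g^1,g^2$. **Belief update.** Let $\mathcal S_t=\Delta\mathcal X_t$, $\mathcal B_t^1=\{\text{maps }\mathcal X_t\to\Delta\mathcal U_t^1\}$, $\mathcal B_t^2=\Delta\mathcal U_t^2$ (prescriptions), and write $\gamma^1(x;u)$ for the probability of $u$ under $\gamma^1(x)$. For $z=(y^2,u^2)$ put $$Q_t(\pi,\gamma^1,z;x')=\sum_{x,u^1}\pi(x)\gamma^1(x;u^1)\,\mathbb P[X_{t+1}=x',Y_{t+1}^2=y^2\mid X_t=x,U_t^1=u^1,U_t^2=u^2],\quad R_t(\pi,\gamma^1,z)=\sum_{x'}Q_t(\pi,\gamma^1,z;x').$$ $F_t(\pi,\gamma^1,z)=Q_t(\pi,\gamma^1,z;\cdot)/R_t(\pi,\gamma^1,z)$ if $R_t(\pi,\gamma^1,z)>0$, and $F_t(\pi,\gamma^1,z)$ is the uniform distribution on $\mathcal X_{t+1}$ otherwise. **Min-max dynamic program.** Let $\tilde c_t(\pi,\gamma^1,\gamma^2)=\sum_{x,u^1,u^2}c_t(x,u^1,u^2)\pi(x)\gamma^1(x;u^1)\gamma^2(u^2)$, $V_{T+1}^u\equiv0$, and for $t\le T$ $$w_t^u(\pi_t,\gamma_t^1,\gamma_t^2)=\tilde c_t(\pi_t,\gamma_t^1,\gamma_t^2)+\mathbb E[V_{t+1}^u(F_t(\pi_t,\gamma_t^1,Z_{t+1}))\mid\pi_t,\gamma_t^{1:2}],\quad V_t^u(\pi_t)=\inf_{\gamma_t^1\in\mathcal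 B_t^1}\sup_{\gamma_t^2\in\mathcal B_t^2}w_t^u(\pi_t,\gamma_t^1,\gamma_t^2),$$ where given $(\pi_t,\gamma_t^{1:2})$ the variable $Z_{t+1}=(Y_{t+1}^2,U_t^2)$ equals $z=(y^2,u^2)$ with probability $\gamma_t^2(u^2)R_t(\pi_t,\gamma_t^1,z)$. The map $\Xi_t^1:\mathcal S_t\to\mathcal B_t^1$ is measurable with $V_t^u(\pi_t)=\max_{\gamma_t^2}w_t^u(\pi_t,\Xi_t^1(\pi_t),\gamma_t^2)$ for all $\pi_t$ (such a map exists). *)

theory Defs
  imports "HOL-Probability.Probability"
begin

text \<open>
  All time indices are the mathematical ones, starting at 1. The time-dependent finite sets are
  subsets of fixed carrier types, and the primitive random variables enter through their laws.
\<close>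

record ('x, 'u1, 'u2, 'y, 'ws, 'w2) game =
  horizon :: nat
  states :: "nat \<Rightarrow> 'x set"
  actions1 :: "nat \<Rightarrow> 'u1 set"
  actions2 :: "nat \<Rightarrow> 'u2 set"
  observations :: "nat \<Rightarrow> 'y set"
  init_law :: "'x pmf"
  noise_s :: "nat \<Rightarrow> 'ws pmf"
  noise_o :: "nat \<Rightarrow> 'w2 pmf"
  trans_map :: "nat \<Rightarrow> 'x \<Rightarrow> 'u1 \<Rightarrow> 'u2 \<Rightarrow> 'ws \<Rightarrow> 'x"
  obs_map1 :: "'x \<Rightarrow> 'w2 \<Rightarrow> 'y"  \<comment> \<open>the map \<open>h\<^sub>1\<^sup>2\<close>, which has no action arguments\<close>
  obs_map :: "nat \<Rightarrow> 'x \<Rightarrow> 'u1 \<Rightarrow> 'u2 \<Rightarrow> 'w2 \<Rightarrow> 'y"  \<comment> \<open>used at times \<open>t \<ge> 2\<close> only\<close>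
  cost :: "nat \<Rightarrow> 'x \<Rightarrow> 'u1 \<Rightarrow> 'u2 \<Rightarrow> real"

definition valid_game :: "('x, 'u1, 'u2, 'y, 'ws, 'w2) game \<Rightarrow> bool" where
  "valid_game G \<longleftrightarrow>
    1 \<le> horizon G \<and>
    (\<forall>t\<in>{1..horizon G + 1}. finite (states G t) \<and> finite (observations G t)) \<and>
    (\<forall>t\<in>{1..horizon G}. finite (actions1 G t) \<and> actions1 G t \<noteq> {}
                       \<and> finite (actions2 G t) \<and> actions2 G t \<noteq> {}) \<and>
    set_pmf (init_law G) \<subseteq> states G 1 \<and>
    (\<forall>t\<in>{1..horizon G}. finite (set_pmf (noise_s G t))) \<and>
    (\<forall>t\<in>{1..horizon G + 1}. finite (set_pmf (noise_o G t))) \<and>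
    (\<forall>t\<in>{1..horizon G}. \<forall>x\<in>states G t. \<forall>u1\<in>actions1 G t. \<forall>u2\<in>actions2 G t.
       \<forall>w\<in>set_pmf (noise_s G t). trans_map G t x u1 u2 w \<in> states G (t + 1)) \<and>
    (\<forall>x\<in>states G 1. \<forall>w\<in>set_pmf (noise_o G 1). obs_map1 G x w \<in> observations G 1) \<and>
    (\<forall>t\<in>{1..horizon G}. \<forall>x\<in>states G (t + 1). \<forall>u1\<in>actions1 G t. \<forall>u2\<in>actions2 G t.
       \<forall>w\<in>set_pmf (noise_o G (t + 1)). obs_map G (t + 1) x u1 u2 w \<in> observations G (t + 1))"

definition prob_simplex :: "'a set \<Rightarrow> 'a pmf set" where
  "prob_simplex A = {p. set_pmf p \<subseteq> A}"

text \<open>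
  A realization of the common information at time \<open>t\<close> is the pair of lists
  \<open>([y\<^sub>1, \<dots>, y\<^sub>t], [u\<^sub>1, \<dots>, u\<^sub>t\<^sub>-\<^sub>1])\<close> of player 2's observations and actions, oldest first.
\<close>

type_synonym ('y, 'u2) common_info = "'y list \<times> 'u2 list"
type_synonym ('x, 'u1, 'u2, 'y) strategy1 = "nat \<Rightarrow> 'x \<Rightarrow> ('y, 'u2) common_info \<Rightarrow> 'u1 pmf"
type_synonym ('u2, 'y) strategy2 = "nat \<Rightarrow> ('y, 'u2) common_info \<Rightarrow> 'u2 pmf"

definition common_infos ::
  "('x, 'u1, 'u2, 'y, 'ws, 'w2) game \<Rightarrow> nat \<Rightarrow> ('y, 'u2) common_info set" where
  "common_infos G t = {(ys, us). length ys = t \<and> length us = t - 1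
     \<and> (\<forall>i\<in>{1..t}. ys ! (i - 1) \<in> observations G i)
     \<and> (\<forall>i\<in>{1..<t}. us ! (i - 1) \<in> actions2 G i)}"

definition strategies1 ::
  "('x, 'u1, 'u2, 'y, 'ws, 'w2) game \<Rightarrow> ('x, 'u1, 'u2, 'y) strategy1 set" where
  "strategies1 G =
     (\<Pi> t\<in>{1..horizon G}. states G t \<rightarrow> common_infos G t \<rightarrow> prob_simplex (actions1 G t))"

definition strategies2 ::
  "('x, 'u1, 'u2, 'y, 'ws, 'w2) game \<Rightarrow> ('u2, 'y) strategy2 set" where
  "strategies2 G = (\<Pi> t\<in>{1..horizon G}. common_infos G t \<rightarrow> prob_simplex (actions2 G t))"

text \<open>
  Mutual independence of the primitive random variables and of the players' randomizations is
  expressed by drawing each of them afresh, from its own law, at the time it is used.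
  \<open>initial_law\<close> is the law of \<open>(X\<^sub>1, Y\<^sub>1)\<close>. \<open>step_law G t x u1 u2\<close> is the law of
  \<open>(X\<^sub>t\<^sub>+\<^sub>1, Y\<^sub>t\<^sub>+\<^sub>1)\<close> given \<open>(X\<^sub>t, U\<^sub>t) = (x, u1, u2)\<close>.
\<close>

definition initial_law :: "('x, 'u1, 'u2, 'y, 'ws, 'w2) game \<Rightarrow> ('x \<times> 'y) pmf" where
  "initial_law G = do {
     x \<leftarrow> init_law G;
     w \<leftarrow> noise_o G 1;
     return_pmf (x, obs_map1 G x w) }"

definition step_law ::
  "('x, 'u1, 'u2, 'y, 'ws, 'w2) game \<Rightarrow> nat \<Rightarrow> 'x \<Rightarrow> 'u1 \<Rightarrow> 'u2 \<Rightarrow> ('x \<times> 'y) pmf" where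
  "step_law G t x u1 u2 = do {
     ws \<leftarrow> noise_s G t;
     w2 \<leftarrow> noise_o G (t + 1);
     let x' = trans_map G t x u1 u2 ws;
     return_pmf (x', obs_map G (t + 1) x' u1 u2 w2) }"

text \<open>
  \<open>play_law G g1 g2 n\<close> is the joint law of
  \<open>(X\<^sub>1, \<dots>, X\<^sub>n\<^sub>+\<^sub>1)\<close>, \<open>(U\<^sub>1\<^sup>1, \<dots>, U\<^sub>n\<^sup>1)\<close>, \<open>(U\<^sub>1\<^sup>2, \<dots>, U\<^sub>n\<^sup>2)\<close> and \<open>(Y\<^sub>1, \<dots>, Y\<^sub>n\<^sub>+\<^sub>1)\<close>.
\<close>

primrec play_law ::
  "('x, 'u1, 'u2, 'y, 'ws, 'w2) game \<Rightarrow> ('x, 'u1, 'u2, 'y) strategy1 \<Rightarrow> ('u2, 'y) strategy2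
   \<Rightarrow> nat \<Rightarrow> ('x list \<times> 'u1 list \<times> 'u2 list \<times> 'y list) pmf" where
  "play_law G g1 g2 0 = do {
     (x, y) \<leftarrow> initial_law G;
     return_pmf ([x], [], [], [y]) }"
| "play_law G g1 g2 (Suc n) = do {
     (xs, us1, us2, ys) \<leftarrow> play_law G g1 g2 n;
     u1 \<leftarrow> g1 (Suc n) (last xs) (ys, us2);
     u2 \<leftarrow> g2 (Suc n) (ys, us2);
     (x', y') \<leftarrow> step_law G (Suc n) (last xs) u1 u2;
     return_pmf (xs @ [x'], us1 @ [u1], us2 @ [u2], ys @ [y']) }"

definition expected_cost ::
  "('x, 'u1, 'u2, 'y, 'ws, 'w2) game \<Rightarrow> ('x, 'u1, 'u2, 'y) strategy1 \<Rightarrow> ('u2, 'y) strategy2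
   \<Rightarrow> real" where
  "expected_cost G g1 g2 =
     measure_pmf.expectation (play_law G g1 g2 (horizon G))
       (\<lambda>(xs, us1, us2, ys).
          \<Sum>t=1..horizon G. cost G t (xs ! (t - 1)) (us1 ! (t - 1)) (us2 ! (t - 1)))"

definition nash_equilibrium ::
  "('x, 'u1, 'u2, 'y, 'ws, 'w2) game \<Rightarrow> ('x, 'u1, 'u2, 'y) strategy1 \<Rightarrow> ('u2, 'y) strategy2
   \<Rightarrow> bool" where
  "nash_equilibrium G g1 g2 \<longleftrightarrow> g1 \<in> strategies1 G \<and> g2 \<in> strategies2 G \<and>
     (\<forall>g2'\<in>strategies2 G. expected_cost G g1 g2' \<le> expected_cost G g1 g2) \<and>
     (\<forall>g1'\<in>strategies1 G. expected_cost G g1 g2 \<le> expected_cost G g1' g2)"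

definition beliefs :: "('x, 'u1, 'u2, 'y, 'ws, 'w2) game \<Rightarrow> nat \<Rightarrow> 'x pmf set" where
  "beliefs G t = prob_simplex (states G t)"

definition prescriptions1 ::
  "('x, 'u1, 'u2, 'y, 'ws, 'w2) game \<Rightarrow> nat \<Rightarrow> ('x \<Rightarrow> 'u1 pmf) set" where
  "prescriptions1 G t = states G t \<rightarrow>\<^sub>E prob_simplex (actions1 G t)"

definition prescriptions2 :: "('x, 'u1, 'u2, 'y, 'ws, 'w2) game \<Rightarrow> nat \<Rightarrow> 'u2 pmf set" where
  "prescriptions2 G t = prob_simplex (actions2 G t)"

definition bayes_num ::
  "('x, 'u1, 'u2, 'y, 'ws, 'w2) game \<Rightarrow> nat \<Rightarrow> 'x pmf \<Rightarrow> ('x \<Rightarrow> 'u1 pmf) \<Rightarrow> 'y \<times> 'u2 \<Rightarrow> 'x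
   \<Rightarrow> real" where
  "bayes_num G t \<pi> \<gamma>1 z x' =
     (\<Sum>x\<in>states G t. \<Sum>u1\<in>actions1 G t.
        pmf \<pi> x * pmf (\<gamma>1 x) u1 * pmf (step_law G t x u1 (snd z)) (x', fst z))"

definition bayes_denom ::
  "('x, 'u1, 'u2, 'y, 'ws, 'w2) game \<Rightarrow> nat \<Rightarrow> 'x pmf \<Rightarrow> ('x \<Rightarrow> 'u1 pmf) \<Rightarrow> 'y \<times> 'u2
   \<Rightarrow> real" where
  "bayes_denom G t \<pi> \<gamma>1 z = (\<Sum>x'\<in>states G (t + 1). bayes_num G t \<pi> \<gamma>1 z x')"

text \<open>
  Increments are ordered as \<open>z = (y, u2)\<close>. For arguments in their proper domains the quotient below
  sums to 1 over the whole type, since \<open>bayes_num\<close> vanishes outside \<open>states G (t + 1)\<close>.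
\<close>

definition belief_update ::
  "('x, 'u1, 'u2, 'y, 'ws, 'w2) game \<Rightarrow> nat \<Rightarrow> 'x pmf \<Rightarrow> ('x \<Rightarrow> 'u1 pmf) \<Rightarrow> 'y \<times> 'u2
   \<Rightarrow> 'x pmf" where
  "belief_update G t \<pi> \<gamma>1 z =
     (if bayes_denom G t \<pi> \<gamma>1 z > 0
      then embed_pmf (\<lambda>x'. bayes_num G t \<pi> \<gamma>1 z x' / bayes_denom G t \<pi> \<gamma>1 z)
      else pmf_of_set (states G (t + 1)))"

definition stage_cost ::
  "('x, 'u1, 'u2, 'y, 'ws, 'w2) game \<Rightarrow> nat \<Rightarrow> 'x pmf \<Rightarrow> ('x \<Rightarrow> 'u1 pmf) \<Rightarrow> 'u2 pmf
   \<Rightarrow> real" where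
  "stage_cost G t \<pi> \<gamma>1 \<gamma>2 =
     (\<Sum>x\<in>states G t. \<Sum>u1\<in>actions1 G t. \<Sum>u2\<in>actions2 G t.
        cost G t x u1 u2 * pmf \<pi> x * pmf (\<gamma>1 x) u1 * pmf \<gamma>2 u2)"

text \<open>Here \<open>v\<close> is the value function of the next stage.\<close>

definition cost_to_go ::
  "('x, 'u1, 'u2, 'y, 'ws, 'w2) game \<Rightarrow> nat \<Rightarrow> ('x pmf \<Rightarrow> real)
   \<Rightarrow> 'x pmf \<Rightarrow> ('x \<Rightarrow> 'u1 pmf) \<Rightarrow> 'u2 pmf \<Rightarrow> real" where
  "cost_to_go G t v \<pi> \<gamma>1 \<gamma>2 = stage_cost G t \<pi> \<gamma>1 \<gamma>2 +
     (\<Sum>z\<in>observations G (t + 1) \<times> actions2 G t.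
        pmf \<gamma>2 (snd z) * bayes_denom G t \<pi> \<gamma>1 z * v (belief_update G t \<pi> \<gamma>1 z))"

function upper_value ::
  "('x, 'u1, 'u2, 'y, 'ws, 'w2) game \<Rightarrow> nat \<Rightarrow> 'x pmf \<Rightarrow> real" where
  "upper_value G t =
     (if horizon G < t then (\<lambda>\<pi>. 0)
      else (\<lambda>\<pi>. INF \<gamma>1\<in>prescriptions1 G t. SUP \<gamma>2\<in>prescriptions2 G t.
                  cost_to_go G t (upper_value G (t + 1)) \<pi> \<gamma>1 \<gamma>2))"
  by pat_completeness auto
termination
  by (relation "Wellfounded.measure (\<lambda>(G, t). horizon G + 1 - t)") auto

declare upper_value.simps [simp del]

definition upper_cost ::
  "('x, 'u1, 'u2, 'y, 'ws, 'w2) game \<Rightarrow> nat \<Rightarrow> 'x pmf \<Rightarrow> ('x \<Rightarrow> 'u1 pmf) \<Rightarrow> 'u2 pmf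
   \<Rightarrow> real" where
  "upper_cost G t = cost_to_go G t (upper_value G (t + 1))"

text \<open>For finite \<open>A\<close> this is the Borel \<open>\<sigma>\<close>-algebra of the simplex as a subset of \<open>\<real>\<close> to the power \<open>A\<close>.\<close>

definition simplex_space :: "'a set \<Rightarrow> 'a pmf measure" where
  "simplex_space A =
     vimage_algebra (prob_simplex A) (\<lambda>p. restrict (pmf p) A) (\<Pi>\<^sub>M a\<in>A. borel)"

definition minmax_selector ::
  "('x, 'u1, 'u2, 'y, 'ws, 'w2) game \<Rightarrow> (nat \<Rightarrow> 'x pmf \<Rightarrow> 'x \<Rightarrow> 'u1 pmf) \<Rightarrow> bool" where
  "minmax_selector G \<Xi> \<longleftrightarrow> (\<forall>t\<in>{1..horizon G}.
     \<Xi> t \<in> beliefs G t \<rightarrow> prescriptions1 G t \<and>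
     \<Xi> t \<in> simplex_space (states G t)
              \<rightarrow>\<^sub>M (\<Pi>\<^sub>M x\<in>states G t. simplex_space (actions1 G t)) \<and>
     (\<forall>\<pi>\<in>beliefs G t.
        (\<exists>\<gamma>2\<in>prescriptions2 G t. upper_value G t \<pi> = upper_cost G t \<pi> (\<Xi> t \<pi>) \<gamma>2) \<and>
        (\<forall>\<gamma>2\<in>prescriptions2 G t. upper_cost G t \<pi> (\<Xi> t \<pi>) \<gamma>2 \<le> upper_value G t \<pi>)))"

text \<open>
  The conditional law of \<open>X\<^sub>1\<close> given \<open>Y\<^sub>1 = y\<close>. On null events it is set to the uniform law, as in
  \<open>belief_update\<close>.
\<close>

definition initial_belief :: "('x, 'u1, 'u2, 'y, 'ws, 'w2) game \<Rightarrow> 'y \<Rightarrow> 'x pmf" where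
  "initial_belief G y =
     (if measure_pmf.prob (initial_law G) {(x, y'). y' = y} > 0
      then map_pmf fst (cond_pmf (initial_law G) {(x, y'). y' = y})
      else pmf_of_set (states G 1))"

text \<open>
  \<open>belief G \<Xi> c t\<close> is the belief at time \<open>t \<ge> 1\<close> (the value at 0 is irrelevant); the update from
  time \<open>n\<close> to \<open>n + 1\<close> uses the increment \<open>z\<^sub>n\<^sub>+\<^sub>1 = (y\<^sub>n\<^sub>+\<^sub>1, u\<^sub>n)\<close> of the 0-indexed lists in \<open>c\<close>.
\<close>

primrec belief ::
  "('x, 'u1, 'u2, 'y, 'ws, 'w2) game \<Rightarrow> (nat \<Rightarrow> 'x pmf \<Rightarrow> 'x \<Rightarrow> 'u1 pmf)
   \<Rightarrow> ('y, 'u2) common_info \<Rightarrow> nat \<Rightarrow> 'x pmf" where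
  "belief G \<Xi> c 0 = undefined"
| "belief G \<Xi> c (Suc n) =
     (if n = 0 then initial_belief G (fst c ! 0)
      else belief_update G n (belief G \<Xi> c n) (\<Xi> n (belief G \<Xi> c n)) (fst c ! n, snd c ! (n - 1)))"

definition belief_strategy ::
  "('x, 'u1, 'u2, 'y, 'ws, 'w2) game \<Rightarrow> (nat \<Rightarrow> 'x pmf \<Rightarrow> 'x \<Rightarrow> 'u1 pmf)
   \<Rightarrow> ('x, 'u1, 'u2, 'y) strategy1" where
  "belief_strategy G \<Xi> = (\<lambda>t x c. \<Xi> t (belief G \<Xi> c t) x)"

end

theory Submission
  imports Defs
begin

text \<open>
  Against \<open>g\<^sup>1\<^sup>*\<close> the belief recursion does not depend on player 2's strategy, so backward induction bounds
  \<open>J(g\<^sup>1\<^sup>*, g\<^sup>2)\<close> by the expected value \<open>v\<close> of the dynamic program at the initial belief.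

  For the converse, let \<open>A\<^sub>t\<close> be the set of vectors \<open>\<alpha>\<close> on the states at time \<open>t\<close> such that player 2 can secure
  a cost-to-go of at least \<open>\<alpha> x\<close> simultaneously for every state \<open>x\<close>. These sets are convex, and one minimax argument
  per stage, with player 2 choosing a prescription together with continuation vectors from \<open>A\<^sub>t\<^sub>+\<^sub>1\<close>, shows that
  \<open>V\<^sub>t(\<pi>)\<close> is at most the supremum of \<open>\<langle>\<pi>, \<alpha>\<rangle>\<close> over \<open>A\<^sub>t\<close>. Near-optimal vectors at time 1 yield strategies of player 2 that
  secure \<open>v - \<epsilon>\<close> against every strategy of player 1, and compactness of player 2's strategy space gives one that
  secures \<open>v\<close>. It forms a Nash equilibrium with \<open>g\<^sup>1\<^sup>*\<close>.
\<close>

section \<open>Finite distributions and a minimax alternative\<close>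

text \<open>The belief \<open>\<pi>\<^sub>t\<close> is computed with \<open>\<Xi>\<close>, so it
  ceases to be the conditional law of the state once player 1 deviates, and a strategy of player 2
  driven by it comes with no bound against an arbitrary \<open>g1\<close>. Vectors of guarantees
  avoid this: they are updated from the increments alone, and their inequalities hold for each state
  and each action of player 1.

  In the one-stage cost \<open>\<gamma>1\<close> also enters through the posterior at which the next
  value is taken, which hides the structure that a minimax argument needs. When player 2 chooses the
  continuation vectors too, each payoff is affine in player 1's mixture of pure prescriptions. The
  posterior comes back only after this mixture is fixed, when continuation vectors are selected for
  it. The \<open>\<epsilon>\<close> arises because the sets \<open>A\<^sub>t\<close> are not shown
  to be closed, so their suprema are only approached.\<close>

lemma pmf_embed_pmf_finite:
  fixes f :: "'a \<Rightarrow> real"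
  assumes "finite A" "\<And>a. 0 \<le> f a" "\<And>a. a \<notin> A \<Longrightarrow> f a = 0" "sum f A = 1"
  shows "pmf (embed_pmf f) a = f a"
proof (rule pmf_embed_pmf)
  have "(\<integral>\<^sup>+a. ennreal (f a) \<partial>count_space UNIV) = (\<Sum>a\<in>A. ennreal (f a))"
    using assms by (intro nn_integral_count_space') auto
  also have "\<dots> = 1"
    using assms by (simp add: sum_ennreal)
  finally show "(\<integral>\<^sup>+a. ennreal (f a) \<partial>count_space UNIV) = 1" .
qed (rule assms)

lemma pmf_from_weights:
  fixes f :: "'a \<Rightarrow> real"
  assumes "finite A" "\<And>a. a \<in> A \<Longrightarrow> 0 \<le> f a" "sum f A = 1"
  obtains p where "p \<in> prob_simplex A" "\<And>a. a \<in> A \<Longrightarrow> pmf p a = f a"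
proof -
  define h where "h = (\<lambda>a. if a \<in> A then f a else 0)"
  have h: "pmf (embed_pmf h) a = h a" for a
    using assms by (intro pmf_embed_pmf_finite[of A]) (auto simp: h_def)
  show thesis
  proof
    show "embed_pmf h \<in> prob_simplex A"
      using h by (auto simp: prob_simplex_def set_pmf_iff h_def split: if_splits)
    show "pmf (embed_pmf h) a = f a" if "a \<in> A" for a
      unfolding h using that by (simp add: h_def)
  qed
qed

lemma prob_simplex_nonempty: "A \<noteq> {} \<Longrightarrow> prob_simplex A \<noteq> {}"
  by (metis (mono_tags) all_not_in_conv empty_subsetI insert_subset mem_Collect_eq prob_simplex_def set_return_pmf)

lemma sum_prob_simplex: "p \<in> prob_simplex A \<Longrightarrow> finite A \<Longrightarrow> sum (pmf p) A = 1"
  by (simp add: prob_simplex_def sum_pmf_eq_1)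

lemma expectation_prob_simplex:
  fixes f :: "'a \<Rightarrow> real"
  assumes "p \<in> prob_simplex A" "finite A"
  shows "measure_pmf.expectation p f = (\<Sum>a\<in>A. pmf p a * f a)"
  using assms by (subst integral_measure_pmf_real[of A]) (auto simp: prob_simplex_def mult.commute)

text \<open>
  Here \<open>f\<close> is one of the coordinate constraints \<open>k j \<ge> v\<close> and \<open>h\<close> a mixture of the others. The
  multiplier \<open>\<mu>\<close> is the least one that works on \<open>{f < 0}\<close>; it works on \<open>{f > 0}\<close> because a segment joining
  the two regions crosses \<open>{f = 0}\<close>.
\<close>

lemma lagrange_multiplier:
  fixes f h :: "'k \<Rightarrow> real"
  assumes mix: "\<And>k l a. k \<in> K \<Longrightarrow> l \<in> K \<Longrightarrow> 0 \<le> a \<Longrightarrow> a \<le> 1 \<Longrightarrow>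
                  \<exists>m\<in>K. f m = a * f k + (1 - a) * f l \<and> h m = a * h k + (1 - a) * h l"
    and le: "\<And>k. k \<in> K \<Longrightarrow> 0 \<le> f k \<Longrightarrow> h k \<le> 0"
    and slater: "k0 \<in> K" "0 < f k0"
  obtains \<mu> where "0 \<le> \<mu>" "\<And>k. k \<in> K \<Longrightarrow> h k + \<mu> * f k \<le> 0"
proof -
  \<comment> \<open>The element 0 makes \<open>Sup S\<close> nonnegative and keeps \<open>S\<close>
    nonempty when \<open>f\<close> is never negative on \<open>K\<close>.\<close>
  define S where "S = insert 0 ((\<lambda>l. h l / - f l) ` {l \<in> K. f l < 0})"
  have cross: "s \<le> - h k / f k" if k: "k \<in> K" "0 < f k" and s: "s \<in> S" for k s
  proof (cases "s = 0")
    case True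
    then show ?thesis using le[of k] k by (simp add: divide_nonpos_pos)
  next
    case False
    then obtain l where l: "l \<in> K" "f l < 0" "s = h l / - f l"
      using s by (auto simp: S_def)
    \<comment> \<open>The weight at which the mixture of \<open>f k\<close> and \<open>f l\<close>
      vanishes.\<close>
    define a where "a = - f l / (f k - f l)"
    have d: "0 < f k - f l" using k l by linarith
    have a: "0 \<le> a" "a \<le> 1" "1 - a = f k / (f k - f l)"
      using k l d by (auto simp: a_def field_simps)
    obtain m where m: "m \<in> K" "f m = a * f k + (1 - a) * f l" "h m = a * h k + (1 - a) * h l"
      using mix[OF k(1) l(1) a(1,2)] by blast
    have "f m = 0" using m(2) a(3) by (simp add: a_def)
    then have "h m \<le> 0" using le m(1) by simp
    then have "(- f l * h k + f k * h l) / (f k - f l) \<le> 0"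
      using m(3) a(3) by (simp add: a_def add_divide_distrib diff_divide_distrib)
    then have "f k * h l \<le> f l * h k"
      using d by (simp add: divide_le_0_iff)
    moreover have "s * - f l = h l" using l by simp
    moreover have "(s * f k) * - f l = f k * (s * - f l)" by simp
    ultimately have "(s * f k) * - f l \<le> (- h k) * - f l"
      by (metis minus_mult_minus mult.commute)
    then have "s * f k \<le> - h k"
      by (rule mult_right_le_imp_le) (simp add: l(2))
    with k(2) show ?thesis by (simp only: pos_le_divide_eq)
  qed
  \<comment> \<open>The strictly feasible point \<open>k0\<close> is what bounds the ratios in
    \<open>S\<close> from above.\<close>
  have bdd: "bdd_above S" using cross[OF slater] by (intro bdd_aboveI[of S "- h k0 / f k0"]) simp
  show thesis
  proof
    show "0 \<le> Sup S" using bdd by (intro cSup_upper) (auto simp: S_def)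
    show "h k + Sup S * f k \<le> 0" if k: "k \<in> K" for k
    proof (cases "f k" "0 :: real" rule: linorder_cases)
      case less
      then have "h k / - f k \<le> Sup S"
        using k bdd by (intro cSup_upper) (auto simp: S_def)
      then show ?thesis using less by (simp add: field_simps)
    next
      case equal
      then show ?thesis using le k by simp
    next
      case greater
      then have "Sup S \<le> - h k / f k"
        using cross k by (intro cSup_least) (auto simp: S_def)
      then show ?thesis using greater by (simp add: field_simps)
    qed
  qed
qed

text \<open>Separation of a convex set from an orthant, by induction on the coordinates: on the part
  of \<open>K\<close> with \<open>v \<le> k j\<close> the other coordinates already admit weights,
  and a multiplier for this constraint, used as the weight of \<open>j\<close>, extends the
  inequality to all of \<open>K\<close>. No closedness of \<open>K\<close> enters.\<close>

lemma convex_alternative: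
  fixes K :: "('i \<Rightarrow> real) set"
  assumes "finite I" "I \<noteq> {}"
    and "\<And>k l a. k \<in> K \<Longrightarrow> l \<in> K \<Longrightarrow> 0 \<le> a \<Longrightarrow> a \<le> 1 \<Longrightarrow> (\<lambda>i. a * k i + (1 - a) * l i) \<in> K"
    and "\<And>k. k \<in> K \<Longrightarrow> \<exists>i\<in>I. k i < v"
  shows "\<exists>p. (\<forall>i\<in>I. 0 \<le> p i) \<and> sum p I = 1 \<and> (\<forall>k\<in>K. (\<Sum>i\<in>I. p i * k i) \<le> v)"
  using assms
proof (induction I arbitrary: K rule: finite_ne_induct)
  case (singleton j)
  then show ?case by (intro exI[of _ "\<lambda>_. 1"]) force
next
  case (insert j I)
  show ?case
  proof (cases "\<forall>k\<in>K. k j \<le> v")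
    \<comment> \<open>All weight goes on \<open>j\<close>. In the other case some point of
      \<open>K\<close> exceeds \<open>v\<close> strictly in coordinate \<open>j\<close>, as
      \<open>lagrange_multiplier\<close> demands.\<close>
    case True
    have "(\<Sum>i\<in>insert j I. of_bool (i = j) * k i) = k j" for k :: "'i \<Rightarrow> real"
    proof -
      have "(\<Sum>i\<in>insert j I. of_bool (i = j) * k i) = (\<Sum>i\<in>insert j I. if i = j then k j else 0)"
        by (intro sum.cong) auto
      then show ?thesis using insert.hyps by simp
    qed
    from this this[of "\<lambda>_. 1"] show ?thesis
      using True by (intro exI[of _ "\<lambda>i. of_bool (i = j)"]) simp
  next
    case False
    then obtain k0 where k0: "k0 \<in> K" "v < k0 j" by force
    define K' where "K' = {k \<in> K. v \<le> k j}"
    have "(\<lambda>i. a * k i + (1 - a) * l i) \<in> K'"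
      if "k \<in> K'" "l \<in> K'" "0 \<le> a" "a \<le> 1" for k l a
    proof -
      have "a * v + (1 - a) * v \<le> a * k j + (1 - a) * l j"
        using that by (intro add_mono mult_left_mono) (auto simp: K'_def)
      then show ?thesis using that insert.prems(1) by (simp add: K'_def algebra_simps)
    qed
    moreover have "\<exists>i\<in>I. k i < v" if "k \<in> K'" for k
      using that insert.prems(2)[of k] by (auto simp: K'_def)
    ultimately obtain p where p: "\<forall>i\<in>I. 0 \<le> p i" "sum p I = 1"
        "\<forall>k\<in>K'. (\<Sum>i\<in>I. p i * k i) \<le> v"
      using insert.IH[of K'] by blast
    define h where "h = (\<lambda>k. (\<Sum>i\<in>I. p i * k i) - v)"
    have "\<exists>m\<in>K. m j - v = a * (k j - v) + (1 - a) * (l j - v) \<and> h m = a * h k + (1 - a) * h l"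
      if "k \<in> K" "l \<in> K" "0 \<le> a" "a \<le> 1" for k l a
      using insert.prems(1)[OF that]
      by (intro bexI) (auto simp: h_def algebra_simps sum.distrib sum_distrib_left sum_subtractf)
    moreover have "h k \<le> 0" if "k \<in> K" "0 \<le> k j - v" for k
      using p(3) that by (simp add: K'_def h_def)
    ultimately obtain \<mu> where \<mu>: "0 \<le> \<mu>" "\<And>k. k \<in> K \<Longrightarrow> h k + \<mu> * (k j - v) \<le> 0"
      using k0 by (rule_tac lagrange_multiplier[of K "\<lambda>k. k j - v" h k0]) auto
    \<comment> \<open>Since \<open>p\<close> sums to 1, the total of \<open>p\<close> together with
      \<open>\<mu>\<close> is \<open>1 + \<mu>\<close>.\<close>
    define q where "q = (\<lambda>i. (if i = j then \<mu> else p i) / (1 + \<mu>))"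
    have sum_q: "(\<Sum>i\<in>insert j I. q i * k i) = (\<mu> * k j + (\<Sum>i\<in>I. p i * k i)) / (1 + \<mu>)" for k
    proof -
      have "(\<Sum>i\<in>I. q i * k i) = (\<Sum>i\<in>I. p i * k i) / (1 + \<mu>)"
        unfolding sum_divide_distrib using insert.hyps by (intro sum.cong) (auto simp: q_def)
      then show ?thesis using insert.hyps by (simp add: q_def add_divide_distrib)
    qed
    have "(\<Sum>i\<in>insert j I. q i * k i) \<le> v" if "k \<in> K" for k
      unfolding sum_q using \<mu>(1) \<mu>(2)[OF that] by (simp add: h_def field_simps)
    moreover have "sum q (insert j I) = 1"
      using sum_q[of "\<lambda>_. 1"] p(2) \<mu>(1) by simp
    moreover have "\<forall>i\<in>insert j I. 0 \<le> q i" using p(1) \<mu>(1) by (auto simp: q_def)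
    ultimately show ?thesis by blast
  qed
qed

lemma convergent_subseq_finite:
  fixes f :: "nat \<Rightarrow> 'i \<Rightarrow> real"
  assumes "finite I" "\<And>n i. i \<in> I \<Longrightarrow> \<bar>f n i\<bar> \<le> B"
  shows "\<exists>r. strict_mono r \<and> (\<forall>i\<in>I. convergent (\<lambda>n. f (r n) i))"
  using assms
proof (induction I)
  case empty
  then show ?case using strict_mono_id by auto
next
  case (insert j I)
  then obtain r where r: "strict_mono r" "\<forall>i\<in>I. convergent (\<lambda>n. f (r n) i)" by auto
  have "bounded (range (\<lambda>n. f (r n) j))"
    using insert.prems by (intro boundedI[of _ B]) auto
  then obtain l s where s: "strict_mono (s :: nat \<Rightarrow> nat)" "((\<lambda>n. f (r n) j) \<circ> s) \<longlonglongrightarrow> l"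
    using bounded_imp_convergent_subsequence by blast
  have "convergent (\<lambda>n. f ((r \<circ> s) n) i)" if "i \<in> insert j I" for i
    using that
  proof
    assume "i = j"
    then show ?thesis using s(2) by (auto simp: convergent_def o_def)
  next
    assume "i \<in> I"
    then show ?thesis
      using r(2) convergent_subseq_convergent[OF _ s(1), of "\<lambda>n. f (r n) i"] by (simp add: o_def)
  qed
  then show ?case using strict_mono_o[OF r(1) s(1)] by blast
qed

section \<open>Costs-to-go\<close>

text \<open>Induction on the number of remaining stages. Below, case \<open>1\<close> is a time
  beyond the horizon, where costs and values are 0, and case \<open>2\<close> is a proper
  stage.\<close>

lemma backward_induct:
  fixes n :: nat
  assumes "\<And>t. n < t \<Longrightarrow> P t" "\<And>t. t \<le> n \<Longrightarrow> P (Suc t) \<Longrightarrow> P t"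
  shows "P t"
proof (induction "Suc n - t" arbitrary: t)
  case 0
  then show ?case using assms(1) by simp
next
  case (Suc k)
  then show ?case using assms(2)[of t] Suc.hyps(1)[of "Suc t"] by simp
qed

definition extend_info :: "('y, 'u2) common_info \<Rightarrow> 'y \<times> 'u2 \<Rightarrow> ('y, 'u2) common_info" where
  "extend_info c z = (fst c @ [fst z], snd c @ [snd z])"

text \<open>
  The expected payoff from time \<open>t\<close> on, seen from state \<open>x\<close> and action \<open>u1\<close>, when player 2 draws from \<open>\<gamma>2\<close>
  and the play goes on with value \<open>b z x'\<close> from increment \<open>z\<close> and state \<open>x'\<close>.
\<close>

definition lookahead ::
  "('x, 'u1, 'u2, 'y, 'ws, 'w2) game \<Rightarrow> nat \<Rightarrow> ('y \<times> 'u2 \<Rightarrow> 'x \<Rightarrow> real) \<Rightarrow> 'u2 pmf \<Rightarrow> 'x \<Rightarrow> 'u1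
   \<Rightarrow> real" where
  "lookahead G t b \<gamma>2 x u1 = (\<Sum>u2\<in>actions2 G t. pmf \<gamma>2 u2 *
     (cost G t x u1 u2 + (\<Sum>(x', y)\<in>states G (t + 1) \<times> observations G (t + 1).
        pmf (step_law G t x u1 u2) (x', y) * b (y, u2) x')))"

text \<open>A recursion instead of a conditional expectation, so that it is meaningful at histories
  of probability zero. Current state and common information suffice as arguments because strategies
  see nothing else.\<close>

function cost_from ::
  "('x, 'u1, 'u2, 'y, 'ws, 'w2) game \<Rightarrow> ('x, 'u1, 'u2, 'y) strategy1 \<Rightarrow> ('u2, 'y) strategy2
   \<Rightarrow> nat \<Rightarrow> 'x \<Rightarrow> ('y, 'u2) common_info \<Rightarrow> real" where
  "cost_from G g1 g2 t =
     (if horizon G < t then (\<lambda>x c. 0)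
      else (\<lambda>x c. \<Sum>u1\<in>actions1 G t. pmf (g1 t x c) u1 *
             lookahead G t (\<lambda>z x'. cost_from G g1 g2 (t + 1) x' (extend_info c z)) (g2 t c) x u1))"
  by pat_completeness auto
termination
  by (relation "Wellfounded.measure (\<lambda>(G, g1, g2, t). horizon G + 1 - t)") auto

declare cost_from.simps [simp del]

lemma cost_from_beyond: "horizon G < t \<Longrightarrow> cost_from G g1 g2 t x c = 0"
  by (simp add: cost_from.simps)

lemma cost_from_step:
  "t \<le> horizon G \<Longrightarrow> cost_from G g1 g2 t x c = (\<Sum>u1\<in>actions1 G t. pmf (g1 t x c) u1 *
     lookahead G t (\<lambda>z x'. cost_from G g1 g2 (Suc t) x' (extend_info c z)) (g2 t c) x u1)"
  by (subst cost_from.simps) simp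

section \<open>Averages over finite distributions\<close>

lemma average_mono:
  fixes f :: "'a \<Rightarrow> real"
  assumes "\<And>a. a \<in> A \<Longrightarrow> f a \<le> g a"
  shows "(\<Sum>a\<in>A. pmf p a * f a) \<le> (\<Sum>a\<in>A. pmf p a * g a)"
  using assms by (intro sum_mono mult_left_mono) auto

lemma average_diff_const:
  fixes f :: "'a \<Rightarrow> real"
  assumes "p \<in> prob_simplex A" "finite A"
  shows "(\<Sum>a\<in>A. pmf p a * (f a - e)) = (\<Sum>a\<in>A. pmf p a * f a) - e"
  using sum_prob_simplex[OF assms]
  by (simp add: right_diff_distrib sum_subtractf flip: sum_distrib_right)

lemma average_ge:
  fixes f :: "'a \<Rightarrow> real"
  assumes "p \<in> prob_simplex A" "finite A" "\<And>a. a \<in> A \<Longrightarrow> v \<le> f a"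
  shows "v \<le> (\<Sum>a\<in>A. pmf p a * f a)"
  using average_mono[of A "\<lambda>_. 0" "\<lambda>a. f a - v" p] average_diff_const[OF assms(1,2), of f v] assms(3)
  by simp

lemma average_le:
  fixes f :: "'a \<Rightarrow> real"
  assumes "p \<in> prob_simplex A" "finite A" "\<And>a. a \<in> A \<Longrightarrow> f a \<le> v"
  shows "(\<Sum>a\<in>A. pmf p a * f a) \<le> v"
  using average_ge[OF assms(1,2), of "- v" "\<lambda>a. - f a"] assms(3) by (simp add: sum_negf)

lemma average_abs_le:
  fixes f :: "'a \<Rightarrow> real"
  assumes "p \<in> prob_simplex A" "finite A" "\<And>a. a \<in> A \<Longrightarrow> \<bar>f a\<bar> \<le> v"
  shows "\<bar>\<Sum>a\<in>A. pmf p a * f a\<bar> \<le> v"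
  using average_ge[OF assms(1,2), of "- v" f] average_le[OF assms(1,2), of f v] assms(3)
  by (force simp: abs_le_iff)

context
  fixes G :: "('x, 'u1, 'u2, 'y, 'ws, 'w2) game"
  assumes valid: "valid_game G"
begin

lemma finite_states: "1 \<le> t \<Longrightarrow> t \<le> Suc (horizon G) \<Longrightarrow> finite (states G t)"
  and finite_observations: "1 \<le> t \<Longrightarrow> t \<le> Suc (horizon G) \<Longrightarrow> finite (observations G t)"
  and finite_actions1: "1 \<le> t \<Longrightarrow> t \<le> horizon G \<Longrightarrow> finite (actions1 G t)"
  and finite_actions2: "1 \<le> t \<Longrightarrow> t \<le> horizon G \<Longrightarrow> finite (actions2 G t)"
  and actions1_nonempty: "1 \<le> t \<Longrightarrow> t \<le> horizon G \<Longrightarrow> actions1 G t \<noteq> {}"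
  and actions2_nonempty: "1 \<le> t \<Longrightarrow> t \<le> horizon G \<Longrightarrow> actions2 G t \<noteq> {}"
  using valid unfolding valid_game_def by auto

lemma initial_law_simplex: "initial_law G \<in> prob_simplex (states G 1 \<times> observations G 1)"
  using valid unfolding valid_game_def initial_law_def prob_simplex_def by fastforce

lemma step_law_simplex:
  assumes "1 \<le> t" "t \<le> horizon G" "x \<in> states G t" "u1 \<in> actions1 G t" "u2 \<in> actions2 G t"
  shows "step_law G t x u1 u2 \<in> prob_simplex (states G (Suc t) \<times> observations G (Suc t))"
proof -
  have t: "t \<in> {1..horizon G}" using assms by simp
  have "trans_map G t x u1 u2 w \<in> states G (Suc t)" if "w \<in> set_pmf (noise_s G t)" for w
    using valid t assms that unfolding valid_game_def by (metis Suc_eq_plus1)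
  moreover have "obs_map G (Suc t) x' u1 u2 w \<in> observations G (Suc t)"
    if "w \<in> set_pmf (noise_o G (Suc t))" "x' \<in> states G (Suc t)" for w x'
    using valid t assms that unfolding valid_game_def by (metis Suc_eq_plus1)
  ultimately show ?thesis by (auto simp: prob_simplex_def step_law_def Let_def)
qed

text \<open>Not part of \<open>valid_game\<close>: the supports of \<open>initial_law\<close> and
  \<open>step_law\<close> are nonempty and lie over the state sets. It makes the uniform default in
  \<open>belief_update\<close> a genuine belief.\<close>

lemma states_nonempty:
  assumes "1 \<le> t" "t \<le> Suc (horizon G)"
  shows "states G t \<noteq> {}"
  using assms
proof (induction t rule: dec_induct)
  case base
  then show ?case using initial_law_simplex set_pmf_not_empty[of "initial_law G"]
    by (auto simp: prob_simplex_def)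
next
  case (step t)
  then obtain x u1 u2 where "x \<in> states G t" "u1 \<in> actions1 G t" "u2 \<in> actions2 G t"
    using actions1_nonempty[of t] actions2_nonempty[of t] by fastforce
  then show ?case
    using step step_law_simplex[of t x u1 u2] set_pmf_not_empty[of "step_law G t x u1 u2"]
    by (auto simp: prob_simplex_def)
qed

text \<open>All weights are probabilities, so losing \<open>e\<close> in every continuation loses
  \<open>e\<close> in total. Later uses take \<open>e\<close> as 0 for monotonicity, as a bound on
  the continuation, or as an error to be carried through a stage.\<close>

lemma lookahead_mono_shift:
  assumes t: "1 \<le> t" "t \<le> horizon G" and x: "x \<in> states G t" and u1: "u1 \<in> actions1 G t"
    and \<gamma>: "\<gamma>2 \<in> prob_simplex (actions2 G t)"
    and le: "\<And>z x'. z \<in> observations G (Suc t) \<times> actions2 G t \<Longrightarrow> x' \<in> states G (Suc t) \<Longrightarrow>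
               b z x' - e \<le> b' z x'"
  shows "lookahead G t b \<gamma>2 x u1 - e \<le> lookahead G t b' \<gamma>2 x u1"
proof -
  have fin: "finite (states G (Suc t) \<times> observations G (Suc t))"
    using t by (intro finite_cartesian_product finite_states finite_observations) auto
  have "lookahead G t b \<gamma>2 x u1 - e = (\<Sum>u2\<in>actions2 G t. pmf \<gamma>2 u2 *
     (cost G t x u1 u2 + (\<Sum>p\<in>states G (Suc t) \<times> observations G (Suc t).
        pmf (step_law G t x u1 u2) p * b (snd p, u2) (fst p)) - e))"
    unfolding lookahead_def
    by (subst average_diff_const[OF \<gamma> finite_actions2[OF t]]) (simp add: case_prod_unfold)
  also have "\<dots> \<le> (\<Sum>u2\<in>actions2 G t. pmf \<gamma>2 u2 *
     (cost G t x u1 u2 + (\<Sum>p\<in>states G (Suc t) \<times> observations G (Suc t).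
        pmf (step_law G t x u1 u2) p * b' (snd p, u2) (fst p))))"
  proof (intro average_mono)
    fix u2 assume u2: "u2 \<in> actions2 G t"
    have "(\<Sum>p\<in>states G (Suc t) \<times> observations G (Suc t).
        pmf (step_law G t x u1 u2) p * b (snd p, u2) (fst p)) - e
      \<le> (\<Sum>p\<in>states G (Suc t) \<times> observations G (Suc t).
        pmf (step_law G t x u1 u2) p * b' (snd p, u2) (fst p))"
      unfolding average_diff_const[OF step_law_simplex[OF t x u1 u2] fin, symmetric]
      using u2 by (intro average_mono le) auto
    then show "cost G t x u1 u2 + (\<Sum>p\<in>states G (Suc t) \<times> observations G (Suc t).
        pmf (step_law G t x u1 u2) p * b (snd p, u2) (fst p)) - e \<le>
      cost G t x u1 u2 + (\<Sum>p\<in>states G (Suc t) \<times> observations G (Suc t).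
        pmf (step_law G t x u1 u2) p * b' (snd p, u2) (fst p))" by simp
  qed
  also have "\<dots> = lookahead G t b' \<gamma>2 x u1"
    by (simp add: lookahead_def case_prod_unfold)
  finally show ?thesis .
qed

text \<open>Comparison with the continuation 0 separates the stage cost from the bound
  \<open>M\<close>; \<open>B\<close> is thus chosen before \<open>M\<close>, the continuation and
  the prescription.\<close>

lemma lookahead_bounded:
  assumes t: "1 \<le> t" "t \<le> horizon G"
  obtains B where "\<And>x u1 \<gamma>2 b (M :: real). x \<in> states G t \<Longrightarrow> u1 \<in> actions1 G t \<Longrightarrow>
    \<gamma>2 \<in> prob_simplex (actions2 G t) \<Longrightarrow>
    (\<And>z x'. z \<in> observations G (Suc t) \<times> actions2 G t \<Longrightarrow> x' \<in> states G (Suc t) \<Longrightarrow> \<bar>b z x'\<bar> \<le> M) \<Longrightarrow>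
    \<bar>lookahead G t b \<gamma>2 x u1\<bar> \<le> B + M"
proof
  define C where "C = (\<lambda>(x, u1, u2). \<bar>cost G t x u1 u2\<bar>)"
  define B where "B = sum C (states G t \<times> actions1 G t \<times> actions2 G t)"
  fix x u1 \<gamma>2 b and M :: real
  assume x: "x \<in> states G t" and u1: "u1 \<in> actions1 G t" and \<gamma>: "\<gamma>2 \<in> prob_simplex (actions2 G t)"
    and M: "\<And>z x'. z \<in> observations G (Suc t) \<times> actions2 G t \<Longrightarrow> x' \<in> states G (Suc t) \<Longrightarrow> \<bar>b z x'\<bar> \<le> M"
  have "\<bar>cost G t x u1 u2\<bar> \<le> B" if "u2 \<in> actions2 G t" for u2
    using member_le_sum[of "(x, u1, u2)" "states G t \<times> actions1 G t \<times> actions2 G t" C]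
      t x u1 that finite_states[of t] finite_actions1[of t] finite_actions2[of t]
    by (auto simp: B_def C_def)
  then have "\<bar>lookahead G t (\<lambda>_ _. 0) \<gamma>2 x u1\<bar> \<le> B"
    unfolding lookahead_def by (intro average_abs_le[OF \<gamma> finite_actions2[OF t]]) simp
  moreover have "lookahead G t (\<lambda>_ _. 0) \<gamma>2 x u1 - M \<le> lookahead G t b \<gamma>2 x u1"
    using M by (intro lookahead_mono_shift[OF t x u1 \<gamma>]) (force simp: abs_le_iff)
  moreover have "lookahead G t b \<gamma>2 x u1 - M \<le> lookahead G t (\<lambda>_ _. 0) \<gamma>2 x u1"
    using M by (intro lookahead_mono_shift[OF t x u1 \<gamma>]) (force simp: abs_le_iff)
  ultimately show "\<bar>lookahead G t b \<gamma>2 x u1\<bar> \<le> B + M" by linarith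
qed

lemma extend_info_common_infos:
  assumes "c \<in> common_infos G t" "1 \<le> t" "z \<in> observations G (Suc t) \<times> actions2 G t"
  shows "extend_info c z \<in> common_infos G (Suc t)"
  using assms unfolding common_infos_def extend_info_def
  by (auto simp: nth_append less_Suc_eq le_Suc_eq)

lemma finite_common_infos:
  assumes "t \<le> Suc (horizon G)"
  shows "finite (common_infos G t)"
proof -
  define A where "A = (\<Union>i\<in>{1..t}. observations G i)"
  define B where "B = (\<Union>i\<in>{1..<t}. actions2 G i)"
  have "finite A" "finite B"
    using assms finite_observations finite_actions2 by (auto simp: A_def B_def)
  then have "finite ({ys. set ys \<subseteq> A \<and> length ys = t} \<times> {us. set us \<subseteq> B \<and> length us = t - 1})"
    by (intro finite_cartesian_product finite_lists_length_eq)
  moreover have "common_infos G t \<subseteq>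
      {ys. set ys \<subseteq> A \<and> length ys = t} \<times> {us. set us \<subseteq> B \<and> length us = t - 1}"
  proof -
    have "set ys \<subseteq> A" if "\<forall>i\<in>{1..length ys}. ys ! (i - 1) \<in> observations G i" "length ys = t" for ys
    proof
      fix y assume "y \<in> set ys"
      then obtain i where "i < length ys" "y = ys ! i" by (auto simp: in_set_conv_nth)
      then show "y \<in> A" using that(2) bspec[OF that(1), of "Suc i"]
        by (auto simp: A_def intro!: bexI[of _ "Suc i"])
    qed
    moreover have "set us \<subseteq> B"
      if "\<forall>i\<in>{1..<t}. us ! (i - 1) \<in> actions2 G i" "length us = t - 1" for us
    proof
      fix u assume "u \<in> set us"
      then obtain i where "i < length us" "u = us ! i" by (auto simp: in_set_conv_nth)
      then show "u \<in> B" using that(2) bspec[OF that(1), of "Suc i"]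
        by (auto simp: B_def intro!: bexI[of _ "Suc i"])
    qed
    ultimately show ?thesis unfolding common_infos_def by auto
  qed
  ultimately show ?thesis by (rule finite_subset[rotated])
qed

lemma strategies1D:
  "g1 \<in> strategies1 G \<Longrightarrow> 1 \<le> t \<Longrightarrow> t \<le> horizon G \<Longrightarrow> x \<in> states G t \<Longrightarrow> c \<in> common_infos G t \<Longrightarrow>
   g1 t x c \<in> prob_simplex (actions1 G t)"
  unfolding strategies1_def by (auto simp: Pi_iff)

lemma strategies2D:
  "g2 \<in> strategies2 G \<Longrightarrow> 1 \<le> t \<Longrightarrow> t \<le> horizon G \<Longrightarrow> c \<in> common_infos G t \<Longrightarrow>
   g2 t c \<in> prob_simplex (actions2 G t)"
  unfolding strategies2_def by (auto simp: Pi_iff)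

text \<open>Real suprema and infima are informative only for bounded families; this uniform bound is
  what later makes \<open>SUP\<close> over player 2's strategies usable.\<close>

lemma cost_from_bounded:
  assumes "1 \<le> t"
  shows "\<exists>B. \<forall>g1\<in>strategies1 G. \<forall>g2\<in>strategies2 G. \<forall>x\<in>states G t. \<forall>c\<in>common_infos G t.
           \<bar>cost_from G g1 g2 t x c\<bar> \<le> B"
  using assms
proof (induction t rule: backward_induct[of "horizon G"])
  case (1 t)
  then show ?case by (auto simp: cost_from_beyond)
next
  case (2 t)
  then obtain M where M: "\<And>g1 g2 x c. g1 \<in> strategies1 G \<Longrightarrow> g2 \<in> strategies2 G \<Longrightarrow>
      x \<in> states G (Suc t) \<Longrightarrow> c \<in> common_infos G (Suc t) \<Longrightarrow> \<bar>cost_from G g1 g2 (Suc t) x c\<bar> \<le> M"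
    by fastforce
  obtain B where B: "\<And>x u1 \<gamma>2 b M. x \<in> states G t \<Longrightarrow> u1 \<in> actions1 G t \<Longrightarrow>
    \<gamma>2 \<in> prob_simplex (actions2 G t) \<Longrightarrow>
    (\<And>z x'. z \<in> observations G (Suc t) \<times> actions2 G t \<Longrightarrow> x' \<in> states G (Suc t) \<Longrightarrow> \<bar>b z x'\<bar> \<le> M) \<Longrightarrow>
    \<bar>lookahead G t b \<gamma>2 x u1\<bar> \<le> B + M"
    using lookahead_bounded 2 by blast
  show ?case
  proof (intro exI ballI)
    fix g1 g2 x c assume "g1 \<in> strategies1 G" "g2 \<in> strategies2 G" "x \<in> states G t"
      "c \<in> common_infos G t"
    then show "\<bar>cost_from G g1 g2 t x c\<bar> \<le> B + M"
      unfolding cost_from_step[OF 2(1)] using 2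
      by (intro average_abs_le B M strategies1D strategies2D extend_info_common_infos finite_actions1) auto
  qed
qed

end

section \<open>Bayes updates of the belief\<close>

lemma expectation_bind_simplex:
  fixes h :: "'b \<Rightarrow> real"
  assumes "p \<in> prob_simplex A" "finite A" "\<And>a. a \<in> A \<Longrightarrow> finite (set_pmf (f a))"
  shows "measure_pmf.expectation (bind_pmf p f) h =
           (\<Sum>a\<in>A. pmf p a * measure_pmf.expectation (f a) h)"
  using assms by (subst pmf_expectation_bind[of A]) (auto simp: prob_simplex_def)

text \<open>The belief at time \<open>n\<close> reads only the first \<open>n\<close> observations
  and \<open>n - 1\<close> actions, hence the asymmetric length conditions.\<close>

lemma belief_extend_prefix:
  assumes "n \<le> length (fst c)" "n \<le> Suc (length (snd c))"
  shows "belief G \<Xi> (extend_info c z) n = belief G \<Xi> c n"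
  using assms by (induction n) (auto simp: extend_info_def nth_append)

lemma belief_extend:
  assumes "c \<in> common_infos G t" "1 \<le> t"
  shows "belief G \<Xi> (extend_info c z) (Suc t) =
           belief_update G t (belief G \<Xi> c t) (\<Xi> t (belief G \<Xi> c t)) z"
proof -
  have "length (fst c) = t" "length (snd c) = t - 1"
    using assms(1) by (auto simp: common_infos_def)
  then show ?thesis
    using assms(2) belief_extend_prefix[of t c G \<Xi> z] by (simp add: extend_info_def nth_append)
qed

context
  fixes G :: "('x, 'u1, 'u2, 'y, 'ws, 'w2) game"
  assumes valid: "valid_game G"
begin

lemma bayes_num_nonneg: "0 \<le> bayes_num G t \<pi> \<gamma>1 z x'"
  unfolding bayes_num_def by (intro sum_nonneg mult_nonneg_nonneg) auto

lemma bayes_num_outside: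
  assumes "1 \<le> t" "t \<le> horizon G" "snd z \<in> actions2 G t" "x' \<notin> states G (Suc t)"
  shows "bayes_num G t \<pi> \<gamma>1 z x' = 0"
proof -
  have "pmf (step_law G t x u1 (snd z)) (x', fst z) = 0"
    if "x \<in> states G t" "u1 \<in> actions1 G t" for x u1
    using step_law_simplex[OF valid assms(1,2) that assms(3)] assms(4)
    by (auto simp: prob_simplex_def set_pmf_iff)
  then show ?thesis by (simp add: bayes_num_def)
qed

text \<open>Multiplying out the quotient removes the case distinction for its users: when the
  denominator is 0, every nonnegative numerator is 0 as well, and the uniform default is weighted by
  0.\<close>

lemma bayes_rule:
  assumes t: "1 \<le> t" "t \<le> horizon G" and z: "snd z \<in> actions2 G t"
  shows "bayes_denom G t \<pi> \<gamma>1 z * pmf (belief_update G t \<pi> \<gamma>1 z) x' = bayes_num G t \<pi> \<gamma>1 z x'"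
    and "belief_update G t \<pi> \<gamma>1 z \<in> beliefs G (Suc t)"
proof -
  have fin: "finite (states G (Suc t))" using finite_states[OF valid] t by simp
  have nonneg: "0 \<le> bayes_num G t \<pi> \<gamma>1 z x'" for x' by (rule bayes_num_nonneg)
  have outside: "x' \<notin> states G (Suc t) \<Longrightarrow> bayes_num G t \<pi> \<gamma>1 z x' = 0" for x'
    by (rule bayes_num_outside[OF t z])
  have "(bayes_denom G t \<pi> \<gamma>1 z * pmf (belief_update G t \<pi> \<gamma>1 z) x' = bayes_num G t \<pi> \<gamma>1 z x') \<and>
    belief_update G t \<pi> \<gamma>1 z \<in> beliefs G (Suc t)"
  proof (cases "bayes_denom G t \<pi> \<gamma>1 z > 0")
    case True
    have "pmf (embed_pmf (\<lambda>x'. bayes_num G t \<pi> \<gamma>1 z x' / bayes_denom G t \<pi> \<gamma>1 z)) x' =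
        bayes_num G t \<pi> \<gamma>1 z x' / bayes_denom G t \<pi> \<gamma>1 z" for x'
    proof (rule pmf_embed_pmf_finite[OF fin])
      show "(\<Sum>x'\<in>states G (Suc t). bayes_num G t \<pi> \<gamma>1 z x' / bayes_denom G t \<pi> \<gamma>1 z) = 1"
        unfolding sum_divide_distrib[symmetric] using True by (simp add: bayes_denom_def)
    qed (use True nonneg outside in auto)
    then have pmf_eq: "pmf (belief_update G t \<pi> \<gamma>1 z) x' =
        bayes_num G t \<pi> \<gamma>1 z x' / bayes_denom G t \<pi> \<gamma>1 z" for x'
      using True by (simp add: belief_update_def)
    then have "belief_update G t \<pi> \<gamma>1 z \<in> beliefs G (Suc t)"
      using outside by (force simp: beliefs_def prob_simplex_def set_pmf_iff)
    then show ?thesis using pmf_eq True by simp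
  next
    case False
    have "0 \<le> bayes_denom G t \<pi> \<gamma>1 z"
      unfolding bayes_denom_def by (intro sum_nonneg nonneg)
    then have denom: "bayes_denom G t \<pi> \<gamma>1 z = 0" using False by simp
    then have "bayes_num G t \<pi> \<gamma>1 z x' = 0"
      using outside nonneg fin by (cases "x' \<in> states G (Suc t)")
        (auto simp: bayes_denom_def sum_nonneg_eq_0_iff)
    moreover have "belief_update G t \<pi> \<gamma>1 z \<in> beliefs G (Suc t)"
      using False fin states_nonempty[OF valid, of "Suc t"] t
      by (simp add: belief_update_def beliefs_def prob_simplex_def)
    ultimately show ?thesis using denom by simp
  qed
  then show "bayes_denom G t \<pi> \<gamma>1 z * pmf (belief_update G t \<pi> \<gamma>1 z) x' = bayes_num G t \<pi> \<gamma>1 z x'"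
    and "belief_update G t \<pi> \<gamma>1 z \<in> beliefs G (Suc t)" by auto
qed

text \<open>The tower property as an identity of finite sums: the next state is conditioned on the
  increment. Regrouping the joint sum by increments exposes the Bayes numerator, which
  \<open>bayes_rule\<close> splits into denominator times posterior.\<close>

lemma expected_lookahead:
  assumes t: "1 \<le> t" "t \<le> horizon G"
  shows "(\<Sum>x\<in>states G t. pmf \<pi> x * (\<Sum>u1\<in>actions1 G t. pmf (\<gamma>1 x) u1 * lookahead G t b \<gamma>2 x u1)) =
    stage_cost G t \<pi> \<gamma>1 \<gamma>2 + (\<Sum>z\<in>observations G (Suc t) \<times> actions2 G t.
      pmf \<gamma>2 (snd z) * bayes_denom G t \<pi> \<gamma>1 z *
        (\<Sum>x'\<in>states G (Suc t). pmf (belief_update G t \<pi> \<gamma>1 z) x' * b z x'))"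
proof -
  \<comment> \<open>The contribution of one tuple of state, two actions, next state and
    observation.\<close>
  define T where "T = (\<lambda>x u1 u2 x' y. pmf \<pi> x * pmf (\<gamma>1 x) u1 * pmf \<gamma>2 u2 *
    pmf (step_law G t x u1 u2) (x', y) * b (y, u2) x')"
  have expand: "(\<Sum>x\<in>states G t. pmf \<pi> x * (\<Sum>u1\<in>actions1 G t. pmf (\<gamma>1 x) u1 * lookahead G t b \<gamma>2 x u1)) =
    stage_cost G t \<pi> \<gamma>1 \<gamma>2 + (\<Sum>x\<in>states G t. \<Sum>u1\<in>actions1 G t. \<Sum>u2\<in>actions2 G t.
      \<Sum>x'\<in>states G (Suc t). \<Sum>y\<in>observations G (Suc t). T x u1 u2 x' y)"
    unfolding lookahead_def stage_cost_def T_def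
    by (simp add: distrib_left sum.distrib sum_distrib_left sum.cartesian_product[symmetric]
        algebra_simps)
  have "(\<Sum>x\<in>states G t. \<Sum>u1\<in>actions1 G t. \<Sum>u2\<in>actions2 G t.
      \<Sum>x'\<in>states G (Suc t). \<Sum>y\<in>observations G (Suc t). T x u1 u2 x' y) =
    (\<Sum>y\<in>observations G (Suc t). \<Sum>u2\<in>actions2 G t.
      \<Sum>x'\<in>states G (Suc t). \<Sum>x\<in>states G t. \<Sum>u1\<in>actions1 G t. T x u1 u2 x' y)"
    unfolding sum.cartesian_product
    by (rule sum.reindex_bij_witness[of _ "\<lambda>(y, u2, x', x, u1). (x, u1, u2, x', y)"
          "\<lambda>(x, u1, u2, x', y). (y, u2, x', x, u1)"]) auto
  also have "\<dots> = (\<Sum>(y, u2)\<in>observations G (Suc t) \<times> actions2 G t.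
      \<Sum>x'\<in>states G (Suc t). \<Sum>x\<in>states G t. \<Sum>u1\<in>actions1 G t. T x u1 u2 x' y)"
    by (rule sum.cartesian_product)
  also have "\<dots> = (\<Sum>z\<in>observations G (Suc t) \<times> actions2 G t.
      pmf \<gamma>2 (snd z) * bayes_denom G t \<pi> \<gamma>1 z *
        (\<Sum>x'\<in>states G (Suc t). pmf (belief_update G t \<pi> \<gamma>1 z) x' * b z x'))"
  proof (rule sum.cong[OF refl])
    fix z assume z: "z \<in> observations G (Suc t) \<times> actions2 G t"
    have "pmf \<gamma>2 (snd z) * bayes_denom G t \<pi> \<gamma>1 z *
        (\<Sum>x'\<in>states G (Suc t). pmf (belief_update G t \<pi> \<gamma>1 z) x' * b z x') =
      (\<Sum>x'\<in>states G (Suc t). pmf \<gamma>2 (snd z) *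
        (bayes_denom G t \<pi> \<gamma>1 z * pmf (belief_update G t \<pi> \<gamma>1 z) x') * b z x')"
      by (simp add: sum_distrib_left mult.assoc)
    also have "\<dots> = (\<Sum>x'\<in>states G (Suc t). pmf \<gamma>2 (snd z) * bayes_num G t \<pi> \<gamma>1 z x' * b z x')"
      using z by (intro sum.cong refl) (auto simp: bayes_rule(1)[OF t])
    finally have num: "pmf \<gamma>2 (snd z) * bayes_denom G t \<pi> \<gamma>1 z *
        (\<Sum>x'\<in>states G (Suc t). pmf (belief_update G t \<pi> \<gamma>1 z) x' * b z x') =
      (\<Sum>x'\<in>states G (Suc t). pmf \<gamma>2 (snd z) * bayes_num G t \<pi> \<gamma>1 z x' * b z x')" .
    show "(case z of (y, u2) \<Rightarrow>
        \<Sum>x'\<in>states G (Suc t). \<Sum>x\<in>states G t. \<Sum>u1\<in>actions1 G t. T x u1 u2 x' y) =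
      pmf \<gamma>2 (snd z) * bayes_denom G t \<pi> \<gamma>1 z *
        (\<Sum>x'\<in>states G (Suc t). pmf (belief_update G t \<pi> \<gamma>1 z) x' * b z x')"
      unfolding num
      by (simp add: case_prod_unfold T_def bayes_num_def sum_distrib_left sum_distrib_right
          mult_ac)
  qed
  finally show ?thesis
    unfolding expand by (rule arg_cong[where f = "(+) (stage_cost G t \<pi> \<gamma>1 \<gamma>2)"])
qed

text \<open>A continuation that ignores the next state integrates to itself under the posterior. In
  this form bounds and shifts for \<open>lookahead\<close> transfer to
  \<open>cost_to_go\<close>.\<close>

lemma cost_to_go_eq_lookahead:
  assumes t: "1 \<le> t" "t \<le> horizon G"
  shows "cost_to_go G t v \<pi> \<gamma>1 \<gamma>2 = (\<Sum>x\<in>states G t. pmf \<pi> x * (\<Sum>u1\<in>actions1 G t.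
    pmf (\<gamma>1 x) u1 * lookahead G t (\<lambda>z _. v (belief_update G t \<pi> \<gamma>1 z)) \<gamma>2 x u1))"
proof -
  have const: "(\<Sum>x'\<in>states G (Suc t). pmf (belief_update G t \<pi> \<gamma>1 z) x' * v (belief_update G t \<pi> \<gamma>1 z))
      = v (belief_update G t \<pi> \<gamma>1 z)" if "snd z \<in> actions2 G t" for z
    using sum_prob_simplex[of "belief_update G t \<pi> \<gamma>1 z" "states G (Suc t)"]
      bayes_rule(2)[OF t that, of \<pi> \<gamma>1] finite_states[OF valid, of "Suc t"] t
    by (simp add: beliefs_def flip: sum_distrib_right)
  show ?thesis
    unfolding expected_lookahead[OF t] cost_to_go_def
    by (simp add: const mem_Times_iff)
qed

text \<open>This direction serves the bound on what player 2 gains against the belief strategy; its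
  mirror image below serves the guarantees of player 2.\<close>

lemma expected_lookahead_le_cost_to_go:
  assumes t: "1 \<le> t" "t \<le> horizon G"
    and le: "\<And>z. z \<in> observations G (Suc t) \<times> actions2 G t \<Longrightarrow>
      (\<Sum>x'\<in>states G (Suc t). pmf (belief_update G t \<pi> \<gamma>1 z) x' * b z x') \<le> v (belief_update G t \<pi> \<gamma>1 z)"
  shows "(\<Sum>x\<in>states G t. pmf \<pi> x * (\<Sum>u1\<in>actions1 G t. pmf (\<gamma>1 x) u1 * lookahead G t b \<gamma>2 x u1))
    \<le> cost_to_go G t v \<pi> \<gamma>1 \<gamma>2"
  unfolding expected_lookahead[OF t] cost_to_go_def
  using le by (auto intro!: sum_mono mult_left_mono mult_nonneg_nonneg sum_nonneg bayes_num_nonneg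
      simp: bayes_denom_def)

lemma cost_to_go_le_expected_lookahead:
  assumes t: "1 \<le> t" "t \<le> horizon G"
    and le: "\<And>z. z \<in> observations G (Suc t) \<times> actions2 G t \<Longrightarrow>
      v (belief_update G t \<pi> \<gamma>1 z) \<le> (\<Sum>x'\<in>states G (Suc t). pmf (belief_update G t \<pi> \<gamma>1 z) x' * b z x')"
  shows "cost_to_go G t v \<pi> \<gamma>1 \<gamma>2 \<le>
    (\<Sum>x\<in>states G t. pmf \<pi> x * (\<Sum>u1\<in>actions1 G t. pmf (\<gamma>1 x) u1 * lookahead G t b \<gamma>2 x u1))"
  unfolding expected_lookahead[OF t] cost_to_go_def
  using le by (auto intro!: sum_mono mult_left_mono mult_nonneg_nonneg sum_nonneg bayes_num_nonneg
      simp: bayes_denom_def)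

lemma initial_belief_bayes:
  "pmf (initial_law G) (x, y) =
     measure_pmf.prob (initial_law G) {(x, y'). y' = y} * pmf (initial_belief G y) x"
  and initial_belief_in_beliefs: "initial_belief G y \<in> beliefs G 1"
proof -
  define S where "S = {(x :: 'x, y'). y' = y}"
  have mem_S: "(a, b) \<in> S \<longleftrightarrow> b = y" for a b by (simp add: S_def)
  have "(pmf (initial_law G) (x, y) = measure_pmf.prob (initial_law G) S * pmf (initial_belief G y) x)
    \<and> initial_belief G y \<in> beliefs G 1"
  proof (cases "measure_pmf.prob (initial_law G) S > 0")
    case True
    then have ne: "set_pmf (initial_law G) \<inter> S \<noteq> {}"
      using measure_Int_set_pmf[of "initial_law G" S] by (auto simp: Int_commute)
    \<comment> \<open>Under the conditional law the observation is \<open>y\<close>, so the only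
      pair with first component \<open>x\<close> that carries mass is \<open>(x, y)\<close>.\<close>
    have "pmf (map_pmf fst (cond_pmf (initial_law G) S)) x =
        measure_pmf.prob (cond_pmf (initial_law G) S) {(x, y)}"
      unfolding pmf_map by (rule measure_prob_cong_0) (auto simp: pmf_cond[OF ne] mem_S)
    also have "\<dots> = pmf (initial_law G) (x, y) / measure_pmf.prob (initial_law G) S"
      by (simp add: measure_pmf_single pmf_cond[OF ne] mem_S)
    finally show ?thesis
      using True initial_law_simplex[OF valid] ne
      by (auto simp: initial_belief_def S_def[symmetric] beliefs_def prob_simplex_def)
  next
    case False
    then have prob: "measure_pmf.prob (initial_law G) S = 0"
      by (simp add: zero_less_measure_iff)
    have "pmf (initial_law G) (x, y) \<le> measure_pmf.prob (initial_law G) S"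
      unfolding measure_pmf_single[symmetric]
      by (rule measure_pmf.finite_measure_mono) (auto simp: mem_S)
    then have "pmf (initial_law G) (x, y) = 0" using prob by (simp add: order_antisym)
    with prob show ?thesis
      using states_nonempty[OF valid, of 1] finite_states[OF valid, of 1]
      by (simp add: initial_belief_def S_def[symmetric] beliefs_def prob_simplex_def)
  qed
  then show "pmf (initial_law G) (x, y) =
     measure_pmf.prob (initial_law G) {(x, y'). y' = y} * pmf (initial_belief G y) x"
    and "initial_belief G y \<in> beliefs G 1" by (auto simp: S_def)
qed

end

section \<open>The expected cost as a cost-to-go\<close>

lemma finite_set_pmf_simplex: "p \<in> prob_simplex A \<Longrightarrow> finite A \<Longrightarrow> finite (set_pmf p)"
  by (auto simp: prob_simplex_def intro: finite_subset)

context
  fixes G :: "('x, 'u1, 'u2, 'y, 'ws, 'w2) game"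
  assumes valid: "valid_game G"
begin

text \<open>Strategies are constrained only on their domains. Knowing that plays stay inside them is
  what turns expectations into finite sums over the given sets.\<close>

lemma play_law_support:
  assumes g: "g1 \<in> strategies1 G" "g2 \<in> strategies2 G" and "n \<le> horizon G"
  shows "finite (set_pmf (play_law G g1 g2 n)) \<and>
    (\<forall>(xs, us1, us2, ys)\<in>set_pmf (play_law G g1 g2 n). length xs = Suc n \<and> length us1 = n \<and>
       last xs \<in> states G (Suc n) \<and> (ys, us2) \<in> common_infos G (Suc n))"
  using assms(3)
proof (induction n)
  case 0
  have "finite (set_pmf (initial_law G))"
    using initial_law_simplex[OF valid] finite_states[OF valid, of 1] finite_observations[OF valid, of 1]
    by (auto simp: prob_simplex_def intro: finite_subset)
  then show ?case
    using initial_law_simplex[OF valid]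
    by (force simp: prob_simplex_def common_infos_def case_prod_unfold)
next
  case (Suc n)
  then have n: "1 \<le> Suc n" "Suc n \<le> horizon G" by auto
  have *: "g1 (Suc n) (last xs) (ys, us2) \<in> prob_simplex (actions1 G (Suc n))"
       "g2 (Suc n) (ys, us2) \<in> prob_simplex (actions2 G (Suc n))"
       "last xs \<in> states G (Suc n)" "(ys, us2) \<in> common_infos G (Suc n)"
       "length xs = Suc n" "length us1 = n"
    if "(xs, us1, us2, ys) \<in> set_pmf (play_law G g1 g2 n)" for xs us1 us2 ys
    using Suc that n strategies1D[OF valid g(1) n] strategies2D[OF valid g(2) n] by fastforce+
  have step: "set_pmf (step_law G (Suc n) x u1 u2) \<subseteq> states G (Suc (Suc n)) \<times> observations G (Suc (Suc n))"
    if "x \<in> states G (Suc n)" "u1 \<in> actions1 G (Suc n)" "u2 \<in> actions2 G (Suc n)" for x u1 u2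
    using step_law_simplex[OF valid n that] by (simp add: prob_simplex_def)
  have fin: "finite (states G (Suc (Suc n)) \<times> observations G (Suc (Suc n)))"
    "finite (actions1 G (Suc n))" "finite (actions2 G (Suc n))"
    using n finite_states[OF valid] finite_observations[OF valid] finite_actions1[OF valid]
      finite_actions2[OF valid] by auto
  have "finite (set_pmf (play_law G g1 g2 (Suc n)))"
    unfolding play_law.simps set_bind_pmf
  proof (intro finite_UN_I)
    show "finite (set_pmf (play_law G g1 g2 n))" using Suc by simp
    fix p assume p: "p \<in> set_pmf (play_law G g1 g2 n)"
    obtain xs us1 us2 ys where p_eq: "p = (xs, us1, us2, ys)" by (cases p)
    show "finite (set_pmf (case p of (xs, us1, us2, ys) \<Rightarrow> do {
     u1 \<leftarrow> g1 (Suc n) (last xs) (ys, us2);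
     u2 \<leftarrow> g2 (Suc n) (ys, us2);
     (x', y') \<leftarrow> step_law G (Suc n) (last xs) u1 u2;
     return_pmf (xs @ [x'], us1 @ [u1], us2 @ [u2], ys @ [y']) }))"
      unfolding p_eq case_prod_conv set_bind_pmf
    proof (intro finite_UN_I)
      note q = *[OF p[unfolded p_eq]]
      show "finite (set_pmf (g1 (Suc n) (last xs) (ys, us2)))"
        by (rule finite_set_pmf_simplex[OF q(1) fin(2)])
      show "finite (set_pmf (g2 (Suc n) (ys, us2)))"
        by (rule finite_set_pmf_simplex[OF q(2) fin(3)])
      fix u1 u2 assume "u1 \<in> set_pmf (g1 (Suc n) (last xs) (ys, us2))"
        "u2 \<in> set_pmf (g2 (Suc n) (ys, us2))"
      then have "u1 \<in> actions1 G (Suc n)" "u2 \<in> actions2 G (Suc n)"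
        using q(1,2) by (auto simp: prob_simplex_def)
      then show "finite (set_pmf (step_law G (Suc n) (last xs) u1 u2))"
        by (rule finite_set_pmf_simplex[OF step_law_simplex[OF valid n q(3)] fin(1)])
    qed (simp add: case_prod_unfold)
  qed
  moreover have "length xs = Suc (Suc n) \<and> length us1 = Suc n \<and> last xs \<in> states G (Suc (Suc n)) \<and>
      (ys, us2) \<in> common_infos G (Suc (Suc n))"
    if mem: "(xs, us1, us2, ys) \<in> set_pmf (play_law G g1 g2 (Suc n))" for xs us1 us2 ys
  proof -
    obtain xs0 us10 us20 ys0 u1 u2 x y where p:
      "(xs0, us10, us20, ys0) \<in> set_pmf (play_law G g1 g2 n)"
      "u1 \<in> set_pmf (g1 (Suc n) (last xs0) (ys0, us20))" "u2 \<in> set_pmf (g2 (Suc n) (ys0, us20))"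
      "(x, y) \<in> set_pmf (step_law G (Suc n) (last xs0) u1 u2)"
      "xs = xs0 @ [x]" "us1 = us10 @ [u1]" "us2 = us20 @ [u2]" "ys = ys0 @ [y]"
      using mem by (auto split: prod.split_asm)
    note q = *[OF p(1)]
    have u: "u1 \<in> actions1 G (Suc n)" "u2 \<in> actions2 G (Suc n)"
      using q p by (auto simp: prob_simplex_def)
    have xy: "x \<in> states G (Suc (Suc n))" "y \<in> observations G (Suc (Suc n))"
      using step[OF q(3) u] p(4) by auto
    show ?thesis
      using extend_info_common_infos[OF valid q(4), of "(y, u2)"] q p(5-) u xy
      by (simp add: extend_info_def)
  qed
  ultimately show ?case by blast
qed

text \<open>A martingale argument: the cost accumulated through time \<open>n\<close> plus the
  cost-to-go from time \<open>n + 1\<close> has the same expectation for every \<open>n\<close>. At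
  0 it is the right-hand side, at the horizon the expected cost.\<close>

lemma expected_cost_eq:
  assumes g: "g1 \<in> strategies1 G" "g2 \<in> strategies2 G"
  shows "expected_cost G g1 g2 = (\<Sum>(x, y)\<in>states G 1 \<times> observations G 1.
           pmf (initial_law G) (x, y) * cost_from G g1 g2 1 x ([y], []))"
proof -
  define h where "h = (\<lambda>n (xs, us1, us2, ys).
    (\<Sum>t=1..n. cost G t (xs ! (t - 1)) (us1 ! (t - 1)) (us2 ! (t - 1))) +
      cost_from G g1 g2 (Suc n) (last xs) (ys, us2))"
  have h_eq: "h n (xs, us1, us2, ys) =
    (\<Sum>t=1..n. cost G t (xs ! (t - 1)) (us1 ! (t - 1)) (us2 ! (t - 1))) +
      cost_from G g1 g2 (Suc n) (last xs) (ys, us2)" for n xs us1 us2 ys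
    by (simp add: h_def)
  have fin0: "finite (states G 1 \<times> observations G 1)"
    using finite_states[OF valid] finite_observations[OF valid] by simp
  have "measure_pmf.expectation (play_law G g1 g2 n) (h n) =
      (\<Sum>(x, y)\<in>states G 1 \<times> observations G 1.
           pmf (initial_law G) (x, y) * cost_from G g1 g2 1 x ([y], []))" if "n \<le> horizon G" for n
    using that
  proof (induction n)
    case 0
    then show ?case
      by (simp add: expectation_bind_simplex[OF initial_law_simplex[OF valid] fin0]
          case_prod_unfold h_def)
  next
    case (Suc n)
    then have n: "1 \<le> Suc n" "Suc n \<le> horizon G" by auto
    note supp = play_law_support[OF g, of n]
    define S where "S = set_pmf (play_law G g1 g2 n)"
    have S: "finite S" "play_law G g1 g2 n \<in> prob_simplex S"
      using supp n by (auto simp: S_def prob_simplex_def)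
    define K where "K = (\<lambda>(xs, us1, us2, ys). do {
       u1 \<leftarrow> g1 (Suc n) (last xs) (ys, us2);
       u2 \<leftarrow> g2 (Suc n) (ys, us2);
       (x', y') \<leftarrow> step_law G (Suc n) (last xs) u1 u2;
       return_pmf (xs @ [x'], us1 @ [u1], us2 @ [u2], ys @ [y']) })"
    have play: "play_law G g1 g2 (Suc n) = bind_pmf (play_law G g1 g2 n) K"
      by (simp add: K_def)
    have fin: "finite (states G (Suc (Suc n)) \<times> observations G (Suc (Suc n)))"
      "finite (actions1 G (Suc n))" "finite (actions2 G (Suc n))"
      using n finite_states[OF valid] finite_observations[OF valid] finite_actions1[OF valid]
        finite_actions2[OF valid] by auto
    \<comment> \<open>One stage of play from \<open>p\<close> preserves \<open>h\<close> on
      average.\<close>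
    have K: "measure_pmf.expectation (K p) (h (Suc n)) = h n p" if p: "p \<in> S" for p
    proof -
      obtain xs us1 us2 ys where p_eq: "p = (xs, us1, us2, ys)" by (cases p)
      have q: "length xs = Suc n" "length us1 = n" "last xs \<in> states G (Suc n)"
          "(ys, us2) \<in> common_infos G (Suc n)" "length us2 = n" "length ys = Suc n"
        using supp n p unfolding p_eq S_def by (auto simp: common_infos_def)
      note a1 = strategies1D[OF valid g(1) n q(3,4)] and a2 = strategies2D[OF valid g(2) n q(4)]
      define C where "C = (\<Sum>t=1..n. cost G t (xs ! (t - 1)) (us1 ! (t - 1)) (us2 ! (t - 1)))"
      define X' where "X' = states G (Suc (Suc n)) \<times> observations G (Suc (Suc n))"
      define b where "b = (\<lambda>z x'. cost_from G g1 g2 (Suc (Suc n)) x' (extend_info (ys, us2) z))"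
      have "xs \<noteq> []" using q(1) by auto
      then have last: "last xs = xs ! n" using q(1) by (simp add: last_conv_nth)
      have C: "(\<Sum>t=1..n. cost G t ((xs @ [x']) ! (t - 1)) ((us1 @ [u1]) ! (t - 1)) ((us2 @ [u2]) ! (t - 1)))
          = C" for x' u1 u2
        unfolding C_def using q by (intro sum.cong) (auto simp: nth_append)
      \<comment> \<open>Written as a subtraction to match \<open>average_diff_const\<close>, which
        then pulls the known costs out of each average.\<close>
      have h_Suc: "h (Suc n) (xs @ [x'], us1 @ [u1], us2 @ [u2], ys @ [y']) =
          b (y', u2) x' - (- C - cost G (Suc n) (last xs) u1 u2)" for x' u1 u2 y'
      proof -
        have "(\<Sum>t=1..Suc n. f t) = (\<Sum>t=1..n. f t) + f (Suc n)" for f :: "nat \<Rightarrow> real" by simp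
        then show ?thesis
          unfolding h_eq using q last C[of x' u1 u2] by (simp add: b_def extend_info_def nth_append)
      qed
      define L where "L = (\<lambda>u1 u2. step_law G (Suc n) (last xs) u1 u2 \<bind>
          (\<lambda>(x', y'). return_pmf (xs @ [x'], us1 @ [u1], us2 @ [u2], ys @ [y'])))"
      have K_eq: "K p = g1 (Suc n) (last xs) (ys, us2) \<bind> (\<lambda>u1. g2 (Suc n) (ys, us2) \<bind> L u1)"
        by (simp add: K_def p_eq L_def)
      define A where "A = (\<lambda>u1 u2. cost G (Suc n) (last xs) u1 u2 + (\<Sum>(x', y)\<in>X'.
             pmf (step_law G (Suc n) (last xs) u1 u2) (x', y) * b (y, u2) x'))"
      have L: "finite (set_pmf (L u1 u2))" "measure_pmf.expectation (L u1 u2) (h (Suc n)) = A u1 u2 - (- C)"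
        if "u1 \<in> actions1 G (Suc n)" "u2 \<in> actions2 G (Suc n)" for u1 u2
      proof -
        note s = step_law_simplex[OF valid n q(3) that, folded X'_def]
        show "finite (set_pmf (L u1 u2))"
          using finite_set_pmf_simplex[OF s fin(1)[folded X'_def]]
          by (simp add: L_def case_prod_unfold)
        show "measure_pmf.expectation (L u1 u2) (h (Suc n)) = A u1 u2 - (- C)"
          using average_diff_const[OF s fin(1)[folded X'_def], of "\<lambda>p. b (snd p, u2) (fst p)"
              "- C - cost G (Suc n) (last xs) u1 u2"]
          unfolding L_def A_def
          by (subst expectation_bind_simplex[OF s fin(1)[folded X'_def]])
            (simp_all add: case_prod_unfold h_Suc)
      qed
      have "finite (set_pmf (g2 (Suc n) (ys, us2) \<bind> L u1))" if "u1 \<in> actions1 G (Suc n)" for u1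
        using finite_set_pmf_simplex[OF a2 fin(3)] L(1)[OF that] a2 by (auto simp: prob_simplex_def)
      moreover have "measure_pmf.expectation (g2 (Suc n) (ys, us2) \<bind> L u1) (h (Suc n)) =
          (\<Sum>u2\<in>actions2 G (Suc n). pmf (g2 (Suc n) (ys, us2)) u2 * (A u1 u2 - (- C)))"
        if "u1 \<in> actions1 G (Suc n)" for u1
        using L that by (subst expectation_bind_simplex[OF a2 fin(3)]) auto
      ultimately have "measure_pmf.expectation (K p) (h (Suc n)) =
          (\<Sum>u1\<in>actions1 G (Suc n). pmf (g1 (Suc n) (last xs) (ys, us2)) u1 *
            (\<Sum>u2\<in>actions2 G (Suc n). pmf (g2 (Suc n) (ys, us2)) u2 * (A u1 u2 - (- C))))"
        unfolding K_eq by (subst expectation_bind_simplex[OF a1 fin(2)]) auto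
      also have "\<dots> = (\<Sum>u1\<in>actions1 G (Suc n). pmf (g1 (Suc n) (last xs) (ys, us2)) u1 *
            (lookahead G (Suc n) b (g2 (Suc n) (ys, us2)) (last xs) u1 - (- C)))"
        unfolding average_diff_const[OF a2 fin(3)] by (simp add: lookahead_def A_def X'_def)
      also have "\<dots> = C + cost_from G g1 g2 (Suc n) (last xs) (ys, us2)"
        unfolding average_diff_const[OF a1 fin(2)] cost_from_step[OF n(2)] by (simp add: b_def)
      finally show ?thesis by (simp add: h_eq C_def p_eq)
    qed
    have "finite (set_pmf (K p))" if "p \<in> S" for p
      using play_law_support[OF g n(2)] that unfolding play set_bind_pmf S_def
      by (auto intro: finite_subset[rotated])
    then have "measure_pmf.expectation (play_law G g1 g2 (Suc n)) (h (Suc n)) =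
        (\<Sum>p\<in>S. pmf (play_law G g1 g2 n) p * h n p)"
      unfolding play using K by (subst expectation_bind_simplex[OF S(2,1)]) auto
    also have "\<dots> = measure_pmf.expectation (play_law G g1 g2 n) (h n)"
      by (rule expectation_prob_simplex[OF S(2,1), symmetric])
    finally show ?case using Suc by simp
  qed
  from this[of "horizon G"] show ?thesis
    by (simp add: expected_cost_def h_def case_prod_unfold cost_from_beyond)
qed

end

section \<open>The value function from both sides\<close>

text \<open>
  \<open>guaranteed G t \<alpha>\<close>: against every strategy of player 1, player 2 can secure a cost-to-go of at least
  \<open>\<alpha> x\<close> simultaneously for every state \<open>x\<close> at time \<open>t\<close>, without observing \<open>x\<close>.
\<close>

inductive guaranteed ::
  "('x, 'u1, 'u2, 'y, 'ws, 'w2) game \<Rightarrow> nat \<Rightarrow> ('x \<Rightarrow> real) \<Rightarrow> bool" for G where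
  final: "horizon G < t \<Longrightarrow> \<forall>x\<in>states G t. \<alpha> x \<le> 0 \<Longrightarrow> guaranteed G t \<alpha>"
| stage: "t \<le> horizon G \<Longrightarrow> \<gamma>2 \<in> prescriptions2 G t \<Longrightarrow>
    \<forall>z\<in>observations G (Suc t) \<times> actions2 G t. guaranteed G (Suc t) (\<beta> z) \<Longrightarrow>
    \<forall>x\<in>states G t. \<forall>u1\<in>actions1 G t. \<alpha> x \<le> lookahead G t \<beta> \<gamma>2 x u1 \<Longrightarrow> guaranteed G t \<alpha>"

lemma guaranteed_beyond: "guaranteed G t \<alpha> \<Longrightarrow> horizon G < t \<Longrightarrow> x \<in> states G t \<Longrightarrow> \<alpha> x \<le> 0"
  by (cases rule: guaranteed.cases) auto

lemma guaranteed_stageE: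
  assumes "guaranteed G t \<alpha>" "t \<le> horizon G"
  obtains \<gamma>2 \<beta> where "\<gamma>2 \<in> prescriptions2 G t"
    "\<forall>z\<in>observations G (Suc t) \<times> actions2 G t. guaranteed G (Suc t) (\<beta> z)"
    "\<forall>x\<in>states G t. \<forall>u1\<in>actions1 G t. \<alpha> x \<le> lookahead G t \<beta> \<gamma>2 x u1"
  using assms(1)
proof cases
  case final
  then show ?thesis using assms(2) by simp
next
  case (stage \<gamma>2 \<beta>)
  then show ?thesis using that by blast
qed

context
  fixes G :: "('x, 'u1, 'u2, 'y, 'ws, 'w2) game"
  assumes valid: "valid_game G"
begin

section \<open>Bounds and one-stage inequalities of the dynamic program\<close>

lemma cost_to_go_bounded:
  assumes t: "1 \<le> t" "t \<le> horizon G" and M: "\<And>\<pi>. \<pi> \<in> beliefs G (Suc t) \<Longrightarrow> \<bar>v \<pi>\<bar> \<le> M"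
  shows "\<exists>B. \<forall>\<pi>\<in>beliefs G t. \<forall>\<gamma>1\<in>prescriptions1 G t. \<forall>\<gamma>2\<in>prescriptions2 G t.
           \<bar>cost_to_go G t v \<pi> \<gamma>1 \<gamma>2\<bar> \<le> B"
proof -
  obtain B where B: "\<And>x u1 \<gamma>2 b (M :: real). x \<in> states G t \<Longrightarrow> u1 \<in> actions1 G t \<Longrightarrow>
    \<gamma>2 \<in> prob_simplex (actions2 G t) \<Longrightarrow>
    (\<And>z x'. z \<in> observations G (Suc t) \<times> actions2 G t \<Longrightarrow> x' \<in> states G (Suc t) \<Longrightarrow> \<bar>b z x'\<bar> \<le> M) \<Longrightarrow>
    \<bar>lookahead G t b \<gamma>2 x u1\<bar> \<le> B + M"
    using lookahead_bounded[OF valid t] by blast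
  show ?thesis
  proof (intro exI ballI)
    fix \<pi> \<gamma>1 \<gamma>2
    assume "\<pi> \<in> beliefs G t" "\<gamma>1 \<in> prescriptions1 G t" "\<gamma>2 \<in> prescriptions2 G t"
    then show "\<bar>cost_to_go G t v \<pi> \<gamma>1 \<gamma>2\<bar> \<le> B + M"
      unfolding cost_to_go_eq_lookahead[OF valid t]
      using t bayes_rule(2)[OF valid t] finite_states[OF valid, of t] finite_actions1[OF valid t]
      by (intro average_abs_le B M)
        (auto simp: beliefs_def prescriptions1_def prescriptions2_def)
  qed
qed

lemma cost_to_go_diff_const:
  assumes t: "1 \<le> t" "t \<le> horizon G"
    and "\<pi> \<in> beliefs G t" "\<gamma>1 \<in> prescriptions1 G t" "\<gamma>2 \<in> prescriptions2 G t"
  shows "cost_to_go G t v \<pi> \<gamma>1 \<gamma>2 - e \<le> cost_to_go G t (\<lambda>\<pi>. v \<pi> - e) \<pi> \<gamma>1 \<gamma>2"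
proof -
  have fin: "finite (states G t)" "finite (actions1 G t)"
    using t finite_states[OF valid, of t] finite_actions1[OF valid t] by auto
  have \<gamma>: "\<pi> \<in> prob_simplex (states G t)" "x \<in> states G t \<Longrightarrow> \<gamma>1 x \<in> prob_simplex (actions1 G t)"
    "\<gamma>2 \<in> prob_simplex (actions2 G t)" for x
    using assms by (auto simp: beliefs_def prescriptions1_def prescriptions2_def)
  let ?L = "\<lambda>v x u1. lookahead G t (\<lambda>z _. v (belief_update G t \<pi> \<gamma>1 z)) \<gamma>2 x u1"
  have "cost_to_go G t v \<pi> \<gamma>1 \<gamma>2 - e =
      (\<Sum>x\<in>states G t. pmf \<pi> x * ((\<Sum>u1\<in>actions1 G t. pmf (\<gamma>1 x) u1 * ?L v x u1) - e))"
    unfolding cost_to_go_eq_lookahead[OF valid t] average_diff_const[OF \<gamma>(1) fin(1)] ..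
  also have "\<dots> = (\<Sum>x\<in>states G t. pmf \<pi> x * (\<Sum>u1\<in>actions1 G t. pmf (\<gamma>1 x) u1 * (?L v x u1 - e)))"
    by (intro sum.cong refl) (simp add: average_diff_const[OF \<gamma>(2) fin(2)])
  also have "\<dots> \<le> (\<Sum>x\<in>states G t. pmf \<pi> x *
      (\<Sum>u1\<in>actions1 G t. pmf (\<gamma>1 x) u1 * ?L (\<lambda>\<pi>. v \<pi> - e) x u1))"
    by (intro average_mono lookahead_mono_shift[OF valid t _ _ \<gamma>(3)]) auto
  also have "\<dots> = cost_to_go G t (\<lambda>\<pi>. v \<pi> - e) \<pi> \<gamma>1 \<gamma>2"
    unfolding cost_to_go_eq_lookahead[OF valid t] ..
  finally show ?thesis .
qed

lemma upper_value_beyond: "horizon G < t \<Longrightarrow> upper_value G t \<pi> = 0"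
  by (simp add: upper_value.simps)

lemma minmax_selectorD:
  assumes "minmax_selector G \<Xi>" "1 \<le> t" "t \<le> horizon G" "\<pi> \<in> beliefs G t"
  shows "\<Xi> t \<pi> \<in> prescriptions1 G t"
    and "\<exists>\<gamma>2\<in>prescriptions2 G t. upper_value G t \<pi> = cost_to_go G t (upper_value G (Suc t)) \<pi> (\<Xi> t \<pi>) \<gamma>2"
    and "\<gamma>2 \<in> prescriptions2 G t \<Longrightarrow>
      cost_to_go G t (upper_value G (Suc t)) \<pi> (\<Xi> t \<pi>) \<gamma>2 \<le> upper_value G t \<pi>"
  using assms unfolding minmax_selector_def upper_cost_def by auto

text \<open>The selector attains the value at every belief, so a bound on \<open>cost_to_go\<close>
  passes to \<open>upper_value\<close> without any analysis of the inf-sup.\<close>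

lemma upper_value_bounded:
  assumes sel: "minmax_selector G \<Xi>" and "1 \<le> t"
  shows "\<exists>B. \<forall>\<pi>\<in>beliefs G t. \<bar>upper_value G t \<pi>\<bar> \<le> B"
  using assms(2)
proof (induction t rule: backward_induct[of "horizon G"])
  case (1 t)
  then show ?case by (auto simp: upper_value_beyond)
next
  case (2 t)
  then obtain M where M: "\<And>\<pi>. \<pi> \<in> beliefs G (Suc t) \<Longrightarrow> \<bar>upper_value G (Suc t) \<pi>\<bar> \<le> M" by auto
  obtain B where B: "\<And>\<pi> \<gamma>1 \<gamma>2. \<pi> \<in> beliefs G t \<Longrightarrow> \<gamma>1 \<in> prescriptions1 G t \<Longrightarrow>
      \<gamma>2 \<in> prescriptions2 G t \<Longrightarrow> \<bar>cost_to_go G t (upper_value G (Suc t)) \<pi> \<gamma>1 \<gamma>2\<bar> \<le> B"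
    using cost_to_go_bounded[OF 2(3,1), where v = "upper_value G (Suc t)", OF M] by blast
  show ?case
  proof (intro exI ballI)
    fix \<pi> assume \<pi>: "\<pi> \<in> beliefs G t"
    obtain \<gamma>2 where "\<gamma>2 \<in> prescriptions2 G t"
      "upper_value G t \<pi> = cost_to_go G t (upper_value G (Suc t)) \<pi> (\<Xi> t \<pi>) \<gamma>2"
      using minmax_selectorD(2)[OF sel 2(3,1) \<pi>] by blast
    then show "\<bar>upper_value G t \<pi>\<bar> \<le> B"
      using B[OF \<pi> minmax_selectorD(1)[OF sel 2(3,1) \<pi>]] by simp
  qed
qed

lemma upper_value_le:
  assumes sel: "minmax_selector G \<Xi>" and t: "1 \<le> t" "t \<le> horizon G" and \<pi>: "\<pi> \<in> beliefs G t"
    and \<gamma>1: "\<gamma>1 \<in> prescriptions1 G t"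
    and le: "\<And>\<gamma>2. \<gamma>2 \<in> prescriptions2 G t \<Longrightarrow> cost_to_go G t (upper_value G (Suc t)) \<pi> \<gamma>1 \<gamma>2 \<le> v"
  shows "upper_value G t \<pi> \<le> v"
proof -
  let ?w = "cost_to_go G t (upper_value G (Suc t)) \<pi>"
  obtain M where M: "\<And>\<pi>. \<pi> \<in> beliefs G (Suc t) \<Longrightarrow> \<bar>upper_value G (Suc t) \<pi>\<bar> \<le> M"
    using upper_value_bounded[OF sel, of "Suc t"] by auto
  obtain B where B: "\<And>\<gamma>1 \<gamma>2. \<gamma>1 \<in> prescriptions1 G t \<Longrightarrow> \<gamma>2 \<in> prescriptions2 G t \<Longrightarrow>
      \<bar>?w \<gamma>1 \<gamma>2\<bar> \<le> B"
    using cost_to_go_bounded[OF t, where v = "upper_value G (Suc t)", OF M] \<pi> by blast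
  have ne: "prescriptions2 G t \<noteq> {}"
    unfolding prescriptions2_def by (rule prob_simplex_nonempty[OF actions2_nonempty[OF valid t]])
  \<comment> \<open>Any fixed prescription of player 2 will do: it bounds all the suprema below by
    \<open>- B\<close>, as the infimum requires.\<close>
  then obtain \<delta> where \<delta>: "\<delta> \<in> prescriptions2 G t" by blast
  have "upper_value G t \<pi> = (INF \<gamma>1\<in>prescriptions1 G t. SUP \<gamma>2\<in>prescriptions2 G t. ?w \<gamma>1 \<gamma>2)"
    using t by (simp add: upper_value.simps[of G t])
  also have "\<dots> \<le> (SUP \<gamma>2\<in>prescriptions2 G t. ?w \<gamma>1 \<gamma>2)"
  proof (rule cINF_lower[OF bdd_belowI2 \<gamma>1])
    fix \<gamma>1 assume \<gamma>1: "\<gamma>1 \<in> prescriptions1 G t"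
    have "- B \<le> ?w \<gamma>1 \<delta>" using B[OF \<gamma>1 \<delta>] by (simp add: abs_le_iff)
    also have "\<dots> \<le> (SUP \<gamma>2\<in>prescriptions2 G t. ?w \<gamma>1 \<gamma>2)"
      using B[OF \<gamma>1] by (intro cSUP_upper[OF \<delta>] bdd_aboveI2[where M = B]) (simp add: abs_le_iff)
    finally show "- B \<le> (SUP \<gamma>2\<in>prescriptions2 G t. ?w \<gamma>1 \<gamma>2)" .
  qed
  also have "\<dots> \<le> v" by (rule cSUP_least[OF ne le])
  finally show ?thesis .
qed

text \<open>The claim covers every history, reachable or not: the belief is only the output of its
  recursion, and the algebraic form of Bayes' rule replaces any appeal to conditional laws along the
  play.\<close>

lemma belief_strategy_cost_le:
  assumes sel: "minmax_selector G \<Xi>" and g2: "g2 \<in> strategies2 G"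
    and "1 \<le> t" "c \<in> common_infos G t" "belief G \<Xi> c t \<in> beliefs G t"
  shows "(\<Sum>x\<in>states G t. pmf (belief G \<Xi> c t) x * cost_from G (belief_strategy G \<Xi>) g2 t x c)
           \<le> upper_value G t (belief G \<Xi> c t)"
  using assms(3-)
proof (induction t arbitrary: c rule: backward_induct[of "horizon G"])
  case (1 t)
  then show ?case by (simp add: cost_from_beyond upper_value_beyond)
next
  case (2 t)
  define \<pi> where "\<pi> = belief G \<Xi> c t"
  have "(\<Sum>x\<in>states G t. pmf \<pi> x * cost_from G (belief_strategy G \<Xi>) g2 t x c) =
    (\<Sum>x\<in>states G t. pmf \<pi> x * (\<Sum>u1\<in>actions1 G t. pmf (\<Xi> t \<pi> x) u1 * lookahead G t
       (\<lambda>z x'. cost_from G (belief_strategy G \<Xi>) g2 (Suc t) x' (extend_info c z)) (g2 t c) x u1))"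
    unfolding cost_from_step[OF 2(1)] by (simp add: belief_strategy_def \<pi>_def)
  also have "\<dots> \<le> cost_to_go G t (upper_value G (Suc t)) \<pi> (\<Xi> t \<pi>) (g2 t c)"
  proof (rule expected_lookahead_le_cost_to_go[OF valid 2(3,1)])
    fix z assume z: "z \<in> observations G (Suc t) \<times> actions2 G t"
    have "belief G \<Xi> (extend_info c z) (Suc t) = belief_update G t \<pi> (\<Xi> t \<pi>) z"
      unfolding \<pi>_def by (rule belief_extend[OF 2(4,3)])
    moreover have "\<dots> \<in> beliefs G (Suc t)" using z by (intro bayes_rule(2)[OF valid 2(3,1)]) auto
    ultimately show "(\<Sum>x'\<in>states G (Suc t). pmf (belief_update G t \<pi> (\<Xi> t \<pi>) z) x' *
        cost_from G (belief_strategy G \<Xi>) g2 (Suc t) x' (extend_info c z)) \<le>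
      upper_value G (Suc t) (belief_update G t \<pi> (\<Xi> t \<pi>) z)"
      using 2(2)[of "extend_info c z"] extend_info_common_infos[OF valid 2(4,3) z] by simp
  qed
  also have "\<dots> \<le> upper_value G t \<pi>"
    using minmax_selectorD(3)[OF sel 2(3,1)] 2(5) strategies2D[OF valid g2 2(3,1,4)]
    by (simp add: \<pi>_def prescriptions2_def)
  finally show ?case by (simp add: \<pi>_def)
qed

text \<open>The history keeps its length \<open>s\<close> while \<open>t\<close> runs up to it,
  since \<open>belief\<close> recurses through earlier times of the same history.\<close>

lemma belief_in_beliefs:
  assumes c: "c \<in> common_infos G s" and s: "s \<le> Suc (horizon G)" and "1 \<le> t" "t \<le> s"
  shows "belief G \<Xi> c t \<in> beliefs G t"
  using assms(3,4)
proof (induction t rule: dec_induct)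
  case base
  then show ?case using initial_belief_in_beliefs[OF valid] by simp
next
  case (step t)
  have "\<forall>i\<in>{1..<s}. snd c ! (i - 1) \<in> actions2 G i"
    using c by (auto simp: common_infos_def)
  from bspec[OF this, of t] have "snd c ! (t - 1) \<in> actions2 G t"
    using step by simp
  then have "belief_update G t (belief G \<Xi> c t) (\<Xi> t (belief G \<Xi> c t)) (fst c ! t, snd c ! (t - 1))
      \<in> beliefs G (Suc t)"
    using step s by (intro bayes_rule(2)[OF valid]) auto
  then show ?case using step by simp
qed

lemma belief_strategy_in_strategies1:
  assumes sel: "minmax_selector G \<Xi>"
  shows "belief_strategy G \<Xi> \<in> strategies1 G"
proof -
  have "\<Xi> t (belief G \<Xi> c t) x \<in> prob_simplex (actions1 G t)"
    if "1 \<le> t" "t \<le> horizon G" "x \<in> states G t" "c \<in> common_infos G t" for t x c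
  proof -
    have "belief G \<Xi> c t \<in> beliefs G t"
      using belief_in_beliefs[OF that(4)] that by simp
    from minmax_selectorD(1)[OF sel that(1,2) this] show ?thesis
      using that(3) by (auto simp: prescriptions1_def)
  qed
  then show ?thesis by (auto simp: strategies1_def belief_strategy_def)
qed

text \<open>Player 2 could secretly draw the first plan with probability \<open>a\<close>. The
  marginal law of the action is \<open>\<delta>\<close>; after action \<open>u\<close> the first
  plan is in use with probability \<open>\<theta> u\<close>, and as \<open>u\<close> is part of the
  increment the continuations can be mixed accordingly.\<close>

lemma mix_continuations:
  assumes t: "1 \<le> t" "t \<le> horizon G" and a: "0 \<le> a" "a \<le> 1"
    and \<gamma>: "\<gamma> \<in> prescriptions2 G t" "\<gamma>' \<in> prescriptions2 G t"
    and \<beta>: "\<And>z. z \<in> Z \<Longrightarrow> Q (\<beta> z)" "\<And>z. z \<in> Z \<Longrightarrow> Q (\<beta>' z)"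
    and Q: "\<And>\<alpha> \<alpha>' \<theta>. Q \<alpha> \<Longrightarrow> Q \<alpha>' \<Longrightarrow> 0 \<le> \<theta> \<Longrightarrow> \<theta> \<le> 1 \<Longrightarrow> Q (\<lambda>x. \<theta> * \<alpha> x + (1 - \<theta>) * \<alpha>' x)"
  shows "\<exists>\<delta>\<in>prescriptions2 G t. \<exists>b. (\<forall>z\<in>Z. Q (b z)) \<and> (\<forall>x u1. lookahead G t b \<delta> x u1 =
           a * lookahead G t \<beta> \<gamma> x u1 + (1 - a) * lookahead G t \<beta>' \<gamma>' x u1)"
proof -
  have fin: "finite (actions2 G t)" by (rule finite_actions2[OF valid t])
  have "(\<Sum>u\<in>actions2 G t. a * pmf \<gamma> u + (1 - a) * pmf \<gamma>' u) = 1"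
    using \<gamma> sum_prob_simplex[OF _ fin]
    by (simp add: prescriptions2_def sum.distrib flip: sum_distrib_left)
  then obtain \<delta> where \<delta>: "\<delta> \<in> prob_simplex (actions2 G t)"
    "\<And>u. u \<in> actions2 G t \<Longrightarrow> pmf \<delta> u = a * pmf \<gamma> u + (1 - a) * pmf \<gamma>' u"
    using a by (rule_tac pmf_from_weights[OF fin, of "\<lambda>u. a * pmf \<gamma> u + (1 - a) * pmf \<gamma>' u"]) auto
  \<comment> \<open>If both plans give \<open>u\<close> probability 0, the quotient is 0 by
    convention; \<open>\<delta>\<close> then gives \<open>u\<close> no weight either.\<close>
  define \<theta> where "\<theta> = (\<lambda>u. a * pmf \<gamma> u / (a * pmf \<gamma> u + (1 - a) * pmf \<gamma>' u))"
  define b where "b = (\<lambda>z x. \<theta> (snd z) * \<beta> z x + (1 - \<theta> (snd z)) * \<beta>' z x)"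
  have nonneg: "0 \<le> a * pmf \<gamma> u" "0 \<le> (1 - a) * pmf \<gamma>' u" for u using a by auto
  have "0 \<le> \<theta> u" "\<theta> u \<le> 1" for u
    using nonneg[of u] by (auto simp: \<theta>_def divide_le_eq_1)
  then have "\<forall>z\<in>Z. Q (b z)" unfolding b_def by (blast intro: Q \<beta>)
  moreover have "lookahead G t b \<delta> x u1 =
      a * lookahead G t \<beta> \<gamma> x u1 + (1 - a) * lookahead G t \<beta>' \<gamma>' x u1" for x u1
  proof -
    define E where "E = (\<lambda>b u2. \<Sum>(x', y)\<in>states G (t + 1) \<times> observations G (t + 1).
        pmf (step_law G t x u1 u2) (x', y) * b (y, u2) x' :: real)"
    have L: "lookahead G t b \<gamma> x u1 = (\<Sum>u\<in>actions2 G t. pmf \<gamma> u * (cost G t x u1 u + E b u))" for b \<gamma>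
      by (simp add: lookahead_def E_def)
    have "pmf \<delta> u * (cost G t x u1 u + E b u) = a * (pmf \<gamma> u * (cost G t x u1 u + E \<beta> u)) +
        (1 - a) * (pmf \<gamma>' u * (cost G t x u1 u + E \<beta>' u))" if u: "u \<in> actions2 G t" for u
    proof -
      have E: "E b u = \<theta> u * E \<beta> u + (1 - \<theta> u) * E \<beta>' u"
        by (simp add: E_def b_def case_prod_unfold sum_distrib_left sum.distrib[symmetric]
            algebra_simps)
      have \<theta>: "pmf \<delta> u * \<theta> u = a * pmf \<gamma> u"
        using nonneg[of u] by (auto simp: \<delta>(2)[OF u] \<theta>_def add_nonneg_eq_0_iff)
      have \<theta>': "pmf \<delta> u * (1 - \<theta> u) = (1 - a) * pmf \<gamma>' u"
        using \<theta> \<delta>(2)[OF u] by (simp add: right_diff_distrib)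
      have "pmf \<delta> u * (cost G t x u1 u + E b u) =
          pmf \<delta> u * cost G t x u1 u + (pmf \<delta> u * \<theta> u) * E \<beta> u + (pmf \<delta> u * (1 - \<theta> u)) * E \<beta>' u"
        unfolding E by (simp add: algebra_simps)
      also have "\<dots> = (a * pmf \<gamma> u + (1 - a) * pmf \<gamma>' u) * cost G t x u1 u +
          a * pmf \<gamma> u * E \<beta> u + (1 - a) * pmf \<gamma>' u * E \<beta>' u"
        by (simp only: \<theta> \<theta>') (simp only: \<delta>(2)[OF u])
      finally show ?thesis by (simp add: algebra_simps)
    qed
    then show ?thesis by (simp add: L sum_distrib_left sum.distrib)
  qed
  ultimately show ?thesis using \<delta>(1) by (auto simp: prescriptions2_def)
qed

text \<open>Convexity of \<open>A\<^sub>t\<close>. The weight varies in the induction because the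
  next stage is mixed with the posterior weight of the plan instead of \<open>a\<close>.\<close>

lemma guaranteed_mix:
  assumes "1 \<le> t" "guaranteed G t \<alpha>" "guaranteed G t \<alpha>'" "0 \<le> a" "a \<le> 1"
  shows "guaranteed G t (\<lambda>x. a * \<alpha> x + (1 - a) * \<alpha>' x)"
  using assms
proof (induction t arbitrary: \<alpha> \<alpha>' a rule: backward_induct[of "horizon G"])
  case (1 t)
  have "a * \<alpha> x + (1 - a) * \<alpha>' x \<le> 0" if "x \<in> states G t" for x
    using guaranteed_beyond[OF 1(3,1) that] guaranteed_beyond[OF 1(4,1) that] 1(5,6)
    by (auto intro!: add_nonpos_nonpos mult_nonneg_nonpos)
  then show ?case by (intro guaranteed.final[OF 1(1)] ballI)
next
  case (2 t)
  obtain \<gamma> \<beta> where s: "\<gamma> \<in> prescriptions2 G t"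
    "\<forall>z\<in>observations G (Suc t) \<times> actions2 G t. guaranteed G (Suc t) (\<beta> z)"
    "\<forall>x\<in>states G t. \<forall>u1\<in>actions1 G t. \<alpha> x \<le> lookahead G t \<beta> \<gamma> x u1"
    by (rule guaranteed_stageE[OF 2(4,1)])
  obtain \<gamma>' \<beta>' where s': "\<gamma>' \<in> prescriptions2 G t"
    "\<forall>z\<in>observations G (Suc t) \<times> actions2 G t. guaranteed G (Suc t) (\<beta>' z)"
    "\<forall>x\<in>states G t. \<forall>u1\<in>actions1 G t. \<alpha>' x \<le> lookahead G t \<beta>' \<gamma>' x u1"
    by (rule guaranteed_stageE[OF 2(5,1)])
  have mix: "guaranteed G (Suc t) (\<lambda>x. \<theta> * \<alpha> x + (1 - \<theta>) * \<alpha>' x)"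
    if "guaranteed G (Suc t) \<alpha>" "guaranteed G (Suc t) \<alpha>'" "0 \<le> \<theta>" "\<theta> \<le> 1" for \<alpha> \<alpha>' \<theta>
    by (rule 2(2)[OF _ that]) simp
  obtain \<delta> b where m: "\<delta> \<in> prescriptions2 G t"
    "\<forall>z\<in>observations G (Suc t) \<times> actions2 G t. guaranteed G (Suc t) (b z)"
    "\<And>x u1. lookahead G t b \<delta> x u1 =
           a * lookahead G t \<beta> \<gamma> x u1 + (1 - a) * lookahead G t \<beta>' \<gamma>' x u1"
    using mix_continuations[OF 2(3,1,6,7) s(1) s'(1),
        where Z = "observations G (Suc t) \<times> actions2 G t" and \<beta> = \<beta> and \<beta>' = \<beta>'
          and Q = "guaranteed G (Suc t)", OF bspec[OF s(2)] bspec[OF s'(2)] mix] by blast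
  show ?case
    using s(3) s'(3) 2(6,7)
    by (intro guaranteed.stage[OF 2(1) m(1,2)] ballI)
      (auto simp: m(3) intro!: add_mono mult_left_mono)
qed

text \<open>
  The minimax step: player 1's pure prescriptions index finitely many payoffs that are affine in player
  2's choice of a prescription together with continuation guarantees, a convex set.
\<close>

lemma upper_value_approx_guaranteed:
  assumes sel: "minmax_selector G \<Xi>" and "1 \<le> t" "\<pi> \<in> beliefs G t" "0 < e"
  shows "\<exists>\<alpha>. guaranteed G t \<alpha> \<and> upper_value G t \<pi> - e \<le> (\<Sum>x\<in>states G t. pmf \<pi> x * \<alpha> x)"
  using assms(2-)
proof (induction t arbitrary: \<pi> e rule: backward_induct[of "horizon G"])
  case (1 t)
  then show ?case
    by (intro exI[of _ "\<lambda>_. 0"]) (auto simp: upper_value_beyond intro: guaranteed.final)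
next
  case (2 t)
  note t = 2(3,1)
  define Z where "Z = observations G (Suc t) \<times> actions2 G t"
  define v where "v = upper_value G t \<pi> - e"
  define I where "I = states G t \<rightarrow>\<^sub>E actions1 G t"
  define K where "K = {k. \<exists>\<gamma>\<in>prescriptions2 G t. \<exists>\<beta>. (\<forall>z\<in>Z. guaranteed G (Suc t) (\<beta> z)) \<and>
    k = (\<lambda>s. \<Sum>x\<in>states G t. pmf \<pi> x * lookahead G t \<beta> \<gamma> x (s x))}"
  have fin: "finite (states G t)" "finite (actions1 G t)"
    using t finite_states[OF valid, of t] finite_actions1[OF valid t] by auto
  have I: "finite I" "I \<noteq> {}"
    using fin actions1_nonempty[OF valid t] by (auto simp: I_def finite_PiE PiE_eq_empty_iff)
  \<comment> \<open>Otherwise some mixture of pure prescriptions holds every vector of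
    \<open>K\<close> to \<open>v\<close>. Turned into a single prescription, it keeps
    \<open>cost_to_go\<close> at or below \<open>v + e / 2\<close>, which is less than the
    value.\<close>
  have "\<exists>k\<in>K. \<forall>s\<in>I. v \<le> k s"
  proof (rule ccontr)
    assume "\<not> ?thesis"
    then have "\<exists>s\<in>I. k s < v" if "k \<in> K" for k using that by force
    moreover have "(\<lambda>s. a * k s + (1 - a) * l s) \<in> K"
      if kl: "k \<in> K" "l \<in> K" and a: "0 \<le> a" "a \<le> 1" for k l a
    proof -
      obtain \<gamma> \<beta> where k: "\<gamma> \<in> prescriptions2 G t" "\<And>z. z \<in> Z \<Longrightarrow> guaranteed G (Suc t) (\<beta> z)"
        "k = (\<lambda>s. \<Sum>x\<in>states G t. pmf \<pi> x * lookahead G t \<beta> \<gamma> x (s x))"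
        using kl(1) by (auto simp: K_def)
      obtain \<gamma>' \<beta>' where l: "\<gamma>' \<in> prescriptions2 G t" "\<And>z. z \<in> Z \<Longrightarrow> guaranteed G (Suc t) (\<beta>' z)"
        "l = (\<lambda>s. \<Sum>x\<in>states G t. pmf \<pi> x * lookahead G t \<beta>' \<gamma>' x (s x))"
        using kl(2) by (auto simp: K_def)
      obtain \<delta> b where m: "\<delta> \<in> prescriptions2 G t" "\<forall>z\<in>Z. guaranteed G (Suc t) (b z)"
        "\<And>x u1. lookahead G t b \<delta> x u1 =
           a * lookahead G t \<beta> \<gamma> x u1 + (1 - a) * lookahead G t \<beta>' \<gamma>' x u1"
        using mix_continuations[OF t a k(1) l(1), where Z = Z and \<beta> = \<beta> and \<beta>' = \<beta>' and Q = "guaranteed G (Suc t)", OF k(2) l(2)]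
          guaranteed_mix[of "Suc t"] by fastforce
      have "(\<lambda>s. a * k s + (1 - a) * l s) =
          (\<lambda>s. \<Sum>x\<in>states G t. pmf \<pi> x * lookahead G t b \<delta> x (s x))"
        by (simp add: k(3) l(3) m(3) sum_distrib_left sum.distrib[symmetric] algebra_simps)
      then show ?thesis using m(1,2) by (auto simp: K_def)
    qed
    ultimately obtain p where p: "\<forall>s\<in>I. 0 \<le> p s" "sum p I = 1"
        "\<And>k. k \<in> K \<Longrightarrow> (\<Sum>s\<in>I. p s * k s) \<le> v"
      using convex_alternative[OF I, of K v] by blast
    obtain P where P: "P \<in> prob_simplex I" "\<And>s. s \<in> I \<Longrightarrow> pmf P s = p s"
      using pmf_from_weights[OF I(1), of p] p(1,2) by blast
    \<comment> \<open>Only the marginal of the action at each state matters, because the payoff is a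
      sum over \<open>x\<close> of terms depending on \<open>s x\<close> alone.\<close>
    define \<gamma>1 where "\<gamma>1 = restrict (\<lambda>x. map_pmf (\<lambda>s. s x) P) (states G t)"
    have "s x \<in> actions1 G t" if "s \<in> set_pmf P" "x \<in> states G t" for s x
      using P(1) that by (auto simp: prob_simplex_def I_def PiE_iff)
    then have \<gamma>1: "\<gamma>1 \<in> prescriptions1 G t"
      by (auto simp: \<gamma>1_def prescriptions1_def prob_simplex_def)
    have mixed: "(\<Sum>u1\<in>actions1 G t. pmf (\<gamma>1 x) u1 * f u1) = (\<Sum>s\<in>I. pmf P s * f (s x))"
      if x: "x \<in> states G t" for x and f :: "'u1 \<Rightarrow> real"
    proof -
      have "\<gamma>1 x \<in> prob_simplex (actions1 G t)" using \<gamma>1 x by (auto simp: prescriptions1_def)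
      from expectation_prob_simplex[OF this fin(2), symmetric]
      have "(\<Sum>u1\<in>actions1 G t. pmf (\<gamma>1 x) u1 * f u1) = measure_pmf.expectation (\<gamma>1 x) f" .
      also have "\<dots> = measure_pmf.expectation P (\<lambda>s. f (s x))" using x by (simp add: \<gamma>1_def)
      also have "\<dots> = (\<Sum>s\<in>I. pmf P s * f (s x))" by (rule expectation_prob_simplex[OF P(1) I(1)])
      finally show ?thesis .
    qed
    have "cost_to_go G t (upper_value G (Suc t)) \<pi> \<gamma>1 \<gamma>2 \<le> v + e / 2"
      if \<gamma>2: "\<gamma>2 \<in> prescriptions2 G t" for \<gamma>2
    proof -
      \<comment> \<open>With \<open>\<gamma>1\<close> fixed, so are the posteriors, and the
        induction hypothesis gives a vector for each. This spends half of \<open>e\<close>; the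
        other half yields the contradiction.\<close>
      have "\<exists>\<alpha>. guaranteed G (Suc t) \<alpha> \<and> upper_value G (Suc t) (belief_update G t \<pi> \<gamma>1 z) - e / 2 \<le>
          (\<Sum>x\<in>states G (Suc t). pmf (belief_update G t \<pi> \<gamma>1 z) x * \<alpha> x)" if "z \<in> Z" for z
        using that 2(5) by (intro 2(2) bayes_rule(2)[OF valid t]) (auto simp: Z_def)
      then obtain \<beta> where \<beta>: "\<And>z. z \<in> Z \<Longrightarrow> guaranteed G (Suc t) (\<beta> z)"
        "\<And>z. z \<in> Z \<Longrightarrow> upper_value G (Suc t) (belief_update G t \<pi> \<gamma>1 z) - e / 2 \<le>
          (\<Sum>x\<in>states G (Suc t). pmf (belief_update G t \<pi> \<gamma>1 z) x * \<beta> z x)"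
        by metis
      define k where "k = (\<lambda>s. \<Sum>x\<in>states G t. pmf \<pi> x * lookahead G t \<beta> \<gamma>2 x (s x))"
      have "cost_to_go G t (upper_value G (Suc t)) \<pi> \<gamma>1 \<gamma>2 - e / 2 \<le>
          cost_to_go G t (\<lambda>\<pi>. upper_value G (Suc t) \<pi> - e / 2) \<pi> \<gamma>1 \<gamma>2"
        by (rule cost_to_go_diff_const[OF t 2(4) \<gamma>1 \<gamma>2])
      also have "\<dots> \<le> (\<Sum>x\<in>states G t. pmf \<pi> x *
          (\<Sum>u1\<in>actions1 G t. pmf (\<gamma>1 x) u1 * lookahead G t \<beta> \<gamma>2 x u1))"
        using \<beta>(2) by (intro cost_to_go_le_expected_lookahead[OF valid t]) (simp add: Z_def)
      also have "\<dots> = (\<Sum>x\<in>states G t. pmf \<pi> x * (\<Sum>s\<in>I. pmf P s * lookahead G t \<beta> \<gamma>2 x (s x)))"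
        by (intro sum.cong refl) (simp add: mixed)
      also have "\<dots> = (\<Sum>s\<in>I. pmf P s * k s)"
        unfolding k_def sum_distrib_left by (subst sum.swap) (simp add: mult.left_commute)
      also have "\<dots> = (\<Sum>s\<in>I. p s * k s)" using P(2) by simp
      also have "\<dots> \<le> v"
      proof (rule p(3))
        show "k \<in> K" using \<gamma>2 \<beta>(1) unfolding K_def k_def by blast
      qed
      finally show ?thesis by simp
    qed
    from upper_value_le[OF sel t 2(4) \<gamma>1 this] show False using 2(5) by (simp add: v_def)
  qed
  then obtain \<gamma> \<beta> where k: "\<gamma> \<in> prescriptions2 G t" "\<forall>z\<in>Z. guaranteed G (Suc t) (\<beta> z)"
    "\<forall>s\<in>I. v \<le> (\<Sum>x\<in>states G t. pmf \<pi> x * lookahead G t \<beta> \<gamma> x (s x))"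
    by (auto simp: K_def)
  \<comment> \<open>Minimizing separately at each state gives a pure prescription that is worst for
    player 2 at all states at once, so a bound on the average becomes a state-by-state
    guarantee.\<close>
  have "\<exists>u\<in>actions1 G t. \<forall>u'\<in>actions1 G t. lookahead G t \<beta> \<gamma> x u \<le> lookahead G t \<beta> \<gamma> x u'" for x
    using ex_is_arg_min_if_finite[OF fin(2) actions1_nonempty[OF valid t], of "lookahead G t \<beta> \<gamma> x"]
    by (auto simp: is_arg_min_linorder)
  then obtain s where s: "\<And>x. s x \<in> actions1 G t"
    "\<And>x u. u \<in> actions1 G t \<Longrightarrow> lookahead G t \<beta> \<gamma> x (s x) \<le> lookahead G t \<beta> \<gamma> x u"
    by metis
  have "restrict s (states G t) \<in> I" using s(1) by (auto simp: I_def)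
  then have "v \<le> (\<Sum>x\<in>states G t. pmf \<pi> x * lookahead G t \<beta> \<gamma> x (s x))"
    using k(3) by fastforce
  moreover have "guaranteed G t (\<lambda>x. lookahead G t \<beta> \<gamma> x (s x))"
    using s(2) by (intro guaranteed.stage[OF 2(1) k(1,2)[unfolded Z_def]]) auto
  ultimately show ?case unfolding v_def by blast
qed

end

section \<open>Optimal strategies of player 2\<close>

text \<open>The recursion pattern of \<open>belief\<close> with an arbitrary memory; player 2's
  memory will be its current vector of guarantees.\<close>

primrec info_recursion ::
  "('y \<Rightarrow> 'a) \<Rightarrow> (nat \<Rightarrow> 'a \<Rightarrow> 'y \<times> 'u2 \<Rightarrow> 'a) \<Rightarrow> ('y, 'u2) common_info \<Rightarrow> nat \<Rightarrow> 'a" where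
  "info_recursion i upd c 0 = undefined"
| "info_recursion i upd c (Suc n) =
     (if n = 0 then i (fst c ! 0)
      else upd n (info_recursion i upd c n) (fst c ! n, snd c ! (n - 1)))"

lemma info_recursion_extend_prefix:
  assumes "n \<le> length (fst c)" "n \<le> Suc (length (snd c))"
  shows "info_recursion i upd (extend_info c z) n = info_recursion i upd c n"
  using assms by (induction n) (auto simp: extend_info_def nth_append)

lemma info_recursion_extend:
  assumes "c \<in> common_infos G t" "1 \<le> t"
  shows "info_recursion i upd (extend_info c z) (Suc t) = upd t (info_recursion i upd c t) z"
proof -
  have "length (fst c) = t" "length (snd c) = t - 1"
    using assms(1) by (auto simp: common_infos_def)
  then show ?thesis
    using assms(2) info_recursion_extend_prefix[of t c i upd z]
    by (simp add: extend_info_def nth_append)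
qed

context
  fixes G :: "('x, 'u1, 'u2, 'y, 'ws, 'w2) game"
  assumes valid: "valid_game G"
begin

lemma initial_common_info: "y \<in> observations G 1 \<Longrightarrow> ([y], []) \<in> common_infos G 1"
  by (auto simp: common_infos_def)

text \<open>Player 2 remembers the vector currently guaranteed, plays the prescription that
  witnesses it and passes to the continuation vector of the observed increment. None of this refers
  to \<open>g1\<close>, so one strategy serves against all.\<close>

lemma strategy2_of_guarantees:
  assumes \<alpha>: "\<And>y. y \<in> observations G 1 \<Longrightarrow> guaranteed G 1 (\<alpha> y)"
  shows "\<exists>g2\<in>strategies2 G. \<forall>g1\<in>strategies1 G. \<forall>x\<in>states G 1. \<forall>y\<in>observations G 1.
           \<alpha> y x \<le> cost_from G g1 g2 1 x ([y], [])"
proof -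
  \<comment> \<open>A prescription is demanded even when \<open>a\<close> is not guaranteed, so that
    the resulting \<open>g2\<close> is a strategy at every history.\<close>
  define P where "P = (\<lambda>t a \<gamma> \<beta>. \<gamma> \<in> prescriptions2 G t \<and> (guaranteed G t a \<longrightarrow>
      (\<forall>z\<in>observations G (Suc t) \<times> actions2 G t. guaranteed G (Suc t) (\<beta> z)) \<and>
      (\<forall>x\<in>states G t. \<forall>u1\<in>actions1 G t. a x \<le> lookahead G t \<beta> \<gamma> x u1)))"
  have "\<exists>\<gamma> \<beta>. 1 \<le> t \<and> t \<le> horizon G \<longrightarrow> P t a \<gamma> \<beta>" for t a
  proof (cases "1 \<le> t \<and> t \<le> horizon G \<and> guaranteed G t a")
    case True
    then have "guaranteed G t a" "t \<le> horizon G" by auto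
    then obtain \<gamma> \<beta> where "\<gamma> \<in> prescriptions2 G t"
      "\<forall>z\<in>observations G (Suc t) \<times> actions2 G t. guaranteed G (Suc t) (\<beta> z)"
      "\<forall>x\<in>states G t. \<forall>u1\<in>actions1 G t. a x \<le> lookahead G t \<beta> \<gamma> x u1"
      by (rule guaranteed_stageE)
    then have "P t a \<gamma> \<beta>" by (simp add: P_def)
    then show ?thesis by blast
  next
    case False
    then have "P t a \<gamma> (\<lambda>_. a)" if "1 \<le> t \<and> t \<le> horizon G" "\<gamma> \<in> prescriptions2 G t" for \<gamma>
      using that by (simp add: P_def)
    moreover have "prescriptions2 G t \<noteq> {}" if "1 \<le> t \<and> t \<le> horizon G"
      using prob_simplex_nonempty actions2_nonempty[OF valid, of t] that
      by (simp add: prescriptions2_def)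
    ultimately show ?thesis by blast
  qed
  then obtain act upd where P: "\<And>t a. 1 \<le> t \<and> t \<le> horizon G \<longrightarrow> P t a (act t a) (upd t a)"
    by metis
  have act: "act t a \<in> prescriptions2 G t" if "1 \<le> t" "t \<le> horizon G" for t a
    using P[of t a] that by (simp add: P_def)
  have upd: "guaranteed G (Suc t) (upd t a z)"
    if "1 \<le> t" "t \<le> horizon G" "guaranteed G t a" "z \<in> observations G (Suc t) \<times> actions2 G t" for t a z
    using P[of t a] that by (auto simp: P_def)
  have le: "a x \<le> lookahead G t (upd t a) (act t a) x u1"
    if "1 \<le> t" "t \<le> horizon G" "guaranteed G t a" "x \<in> states G t" "u1 \<in> actions1 G t" for t a x u1
    using P[of t a] that by (simp add: P_def)
  let ?a = "info_recursion \<alpha> upd"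
  define g2 where "g2 = (\<lambda>t c. act t (?a c t))"
  have g2: "g2 \<in> strategies2 G"
    using act by (auto simp: g2_def strategies2_def prescriptions2_def)
  have main: "?a c t x \<le> cost_from G g1 g2 t x c"
    if "1 \<le> t" "c \<in> common_infos G t" "guaranteed G t (?a c t)" "x \<in> states G t"
      and g1: "g1 \<in> strategies1 G" for t c x g1
    using that(1-4)
  proof (induction t arbitrary: c x rule: backward_induct[of "horizon G"])
    case (1 t)
    then show ?case using guaranteed_beyond[OF 1(4,1,5)] by (simp add: cost_from_beyond)
  next
    case (2 t)
    show ?case
      unfolding cost_from_step[OF 2(1)]
    proof (rule average_ge[OF strategies1D[OF valid g1 2(3,1,6,4)] finite_actions1[OF valid 2(3,1)]])
      fix u1 assume u1: "u1 \<in> actions1 G t"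
      have "?a c t x \<le> lookahead G t (upd t (?a c t)) (g2 t c) x u1"
        unfolding g2_def by (rule le[OF 2(3,1,5,6) u1])
      moreover have "lookahead G t (upd t (?a c t)) (g2 t c) x u1 - 0 \<le>
        lookahead G t (\<lambda>z x'. cost_from G g1 g2 (Suc t) x' (extend_info c z)) (g2 t c) x u1"
      proof (rule lookahead_mono_shift[OF valid 2(3,1,6) u1 strategies2D[OF valid g2 2(3,1,4)]])
        fix z x' assume z: "z \<in> observations G (Suc t) \<times> actions2 G t" and x': "x' \<in> states G (Suc t)"
        note ext = info_recursion_extend[OF 2(4,3), of \<alpha> upd z]
        show "upd t (?a c t) z x' - 0 \<le> cost_from G g1 g2 (Suc t) x' (extend_info c z)"
          using 2(2)[OF _ extend_info_common_infos[OF valid 2(4,3) z] _ x'] upd[OF 2(3,1,5) z]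
          unfolding ext by simp
      qed
      ultimately show "?a c t x \<le>
        lookahead G t (\<lambda>z x'. cost_from G g1 g2 (Suc t) x' (extend_info c z)) (g2 t c) x u1"
        by simp
    qed
  qed
  have "\<alpha> y x \<le> cost_from G g1 g2 1 x ([y], [])"
    if "g1 \<in> strategies1 G" "x \<in> states G 1" "y \<in> observations G 1" for g1 x y
    using main[OF _ initial_common_info[OF that(3)] _ that(2,1)] \<alpha>[OF that(3)] by simp
  then show ?thesis using g2 by blast
qed

text \<open>Up to the horizon a strategy of player 2 amounts to finitely many probabilities, and
  limits of probability vectors are again probability vectors.\<close>

lemma strategies2_compact:
  assumes s: "\<And>n. s n \<in> strategies2 G"
  shows "\<exists>r g. strict_mono (r :: nat \<Rightarrow> nat) \<and> g \<in> strategies2 G \<and>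
    (\<forall>t\<in>{1..horizon G}. \<forall>c\<in>common_infos G t. \<forall>u\<in>actions2 G t.
       (\<lambda>n. pmf (s (r n) t c) u) \<longlonglongrightarrow> pmf (g t c) u)"
proof -
  define I where "I = (SIGMA t:{1..horizon G}. common_infos G t \<times> actions2 G t)"
  have "finite I"
    using finite_common_infos[OF valid] finite_actions2[OF valid] by (auto simp: I_def)
  moreover have "\<bar>case i of (t, c, u) \<Rightarrow> pmf (s n t c) u\<bar> \<le> 1" for n i
    by (auto simp: pmf_le_1 split: prod.split)
  ultimately obtain r where r: "strict_mono r"
      "\<forall>i\<in>I. convergent (\<lambda>n. case i of (t, c, u) \<Rightarrow> pmf (s (r n) t c) u)"
    using convergent_subseq_finite[of I "\<lambda>n (t, c, u). pmf (s n t c) u" 1] by auto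
  have "\<exists>p. t \<in> {1..horizon G} \<and> c \<in> common_infos G t \<longrightarrow> p \<in> prob_simplex (actions2 G t) \<and>
      (\<forall>u\<in>actions2 G t. (\<lambda>n. pmf (s (r n) t c) u) \<longlonglongrightarrow> pmf p u)" for t c
  proof (cases "t \<in> {1..horizon G} \<and> c \<in> common_infos G t")
    case True
    define L where "L = (\<lambda>u. lim (\<lambda>n. pmf (s (r n) t c) u))"
    have fin: "finite (actions2 G t)" using True finite_actions2[OF valid] by simp
    have L: "(\<lambda>n. pmf (s (r n) t c) u) \<longlonglongrightarrow> L u" if "u \<in> actions2 G t" for u
      using bspec[OF r(2), of "(t, c, u)"] True that by (simp add: I_def L_def convergent_LIMSEQ_iff)
    have "(\<lambda>n. \<Sum>u\<in>actions2 G t. pmf (s (r n) t c) u) \<longlonglongrightarrow> sum L (actions2 G t)"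
      by (intro tendsto_sum L)
    moreover have "(\<Sum>u\<in>actions2 G t. pmf (s (r n) t c) u) = 1" for n
      using True by (intro sum_prob_simplex[OF _ fin] strategies2D[OF valid s]) auto
    ultimately have "sum L (actions2 G t) = 1"
      using LIMSEQ_unique[OF _ tendsto_const] by auto
    moreover have "0 \<le> L u" if "u \<in> actions2 G t" for u
      using LIMSEQ_le_const[OF L[OF that]] by auto
    ultimately obtain p where "p \<in> prob_simplex (actions2 G t)"
      "\<And>u. u \<in> actions2 G t \<Longrightarrow> pmf p u = L u"
      using pmf_from_weights[OF fin, of L] by blast
    then show ?thesis using L by auto
  qed auto
  then obtain g where g: "\<And>t c. t \<in> {1..horizon G} \<Longrightarrow> c \<in> common_infos G t \<Longrightarrow>
      g t c \<in> prob_simplex (actions2 G t)"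
    "\<And>t c u. t \<in> {1..horizon G} \<Longrightarrow> c \<in> common_infos G t \<Longrightarrow> u \<in> actions2 G t \<Longrightarrow>
      (\<lambda>n. pmf (s (r n) t c) u) \<longlonglongrightarrow> pmf (g t c) u"
    by metis
  then have "g \<in> strategies2 G" by (auto simp: strategies2_def)
  then show ?thesis using r(1) g(2) by blast
qed

text \<open>For fixed \<open>g1\<close> the cost is a polynomial in player 2's action probabilities,
  so their coordinatewise convergence suffices.\<close>

lemma cost_from_tendsto:
  assumes lim: "\<And>t c u. t \<in> {1..horizon G} \<Longrightarrow> c \<in> common_infos G t \<Longrightarrow> u \<in> actions2 G t \<Longrightarrow>
      (\<lambda>n. pmf (s n t c) u) \<longlonglongrightarrow> pmf (g t c) u"
    and "1 \<le> t" "c \<in> common_infos G t"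
  shows "(\<lambda>n. cost_from G g1 (s n) t x c) \<longlonglongrightarrow> cost_from G g1 g t x c"
  using assms(2,3)
proof (induction t arbitrary: c x rule: backward_induct[of "horizon G"])
  case (1 t)
  then show ?case by (simp add: cost_from_beyond)
next
  case (2 t)
  have "(\<lambda>n. cost_from G g1 (s n) (Suc t) x' (extend_info c (y, u2)))
      \<longlonglongrightarrow> cost_from G g1 g (Suc t) x' (extend_info c (y, u2))"
    if "y \<in> observations G (Suc t)" "u2 \<in> actions2 G t" for x' y u2
    using that by (intro 2(2) extend_info_common_infos[OF valid 2(4,3)]) auto
  then show ?case
    unfolding cost_from_step[OF 2(1)] lookahead_def case_prod_unfold using 2
    by (intro tendsto_sum tendsto_mult tendsto_add tendsto_const lim) auto
qed

section \<open>The value of the game and its attainment by both players\<close>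

lemma expected_cost_by_observation:
  assumes "g1 \<in> strategies1 G" "g2 \<in> strategies2 G"
  shows "expected_cost G g1 g2 = (\<Sum>y\<in>observations G 1.
    measure_pmf.prob (initial_law G) {(x, y'). y' = y} *
      (\<Sum>x\<in>states G 1. pmf (initial_belief G y) x * cost_from G g1 g2 1 x ([y], [])))"
  unfolding expected_cost_eq[OF valid assms] sum.cartesian_product[symmetric]
  by (subst sum.swap) (simp add: initial_belief_bayes[OF valid] sum_distrib_left mult.assoc)

lemma expected_cost_bounded:
  "\<exists>B. \<forall>g1\<in>strategies1 G. \<forall>g2\<in>strategies2 G. \<bar>expected_cost G g1 g2\<bar> \<le> B"
proof -
  obtain B where B: "\<And>g1 g2 x c. g1 \<in> strategies1 G \<Longrightarrow> g2 \<in> strategies2 G \<Longrightarrow> x \<in> states G 1 \<Longrightarrow>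
      c \<in> common_infos G 1 \<Longrightarrow> \<bar>cost_from G g1 g2 1 x c\<bar> \<le> B"
    using cost_from_bounded[OF valid order_refl] by blast
  have "\<bar>expected_cost G g1 g2\<bar> \<le> B" if g: "g1 \<in> strategies1 G" "g2 \<in> strategies2 G" for g1 g2
    unfolding expected_cost_eq[OF valid g] case_prod_unfold prod.collapse
    using finite_states[OF valid] finite_observations[OF valid]
    by (intro average_abs_le[OF initial_law_simplex[OF valid]] B g initial_common_info) auto
  then show ?thesis by blast
qed

lemma sum_prob_observation:
  "(\<Sum>y\<in>observations G 1. measure_pmf.prob (initial_law G) {(x, y'). y' = y}) = 1"
proof -
  have fin: "finite (states G 1)" "finite (observations G 1)"
    using finite_states[OF valid] finite_observations[OF valid] by auto
  have "(\<Sum>y\<in>observations G 1. measure_pmf.prob (initial_law G) {(x, y'). y' = y}) =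
      (\<Sum>y\<in>observations G 1. measure_pmf.prob (initial_law G) {(x, y'). y' = y} *
        (\<Sum>x\<in>states G 1. pmf (initial_belief G y) x))"
    using sum_prob_simplex[OF _ fin(1)] initial_belief_in_beliefs[OF valid]
    by (simp add: beliefs_def)
  also have "\<dots> = (\<Sum>y\<in>observations G 1. \<Sum>x\<in>states G 1. pmf (initial_law G) (x, y))"
    by (simp add: initial_belief_bayes[OF valid] sum_distrib_left)
  also have "\<dots> = (\<Sum>p\<in>states G 1 \<times> observations G 1. pmf (initial_law G) p)"
    by (subst sum.swap) (simp add: sum.cartesian_product)
  also have "\<dots> = 1"
    using fin by (intro sum_prob_simplex[OF initial_law_simplex[OF valid]]) auto
  finally show ?thesis .
qed

text \<open>The number \<open>v\<close> of the overview, averaged over the first observation because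
  the program starts at the belief formed after it.\<close>

definition game_value :: real where
  "game_value = (\<Sum>y\<in>observations G 1. measure_pmf.prob (initial_law G) {(x, y'). y' = y} *
     upper_value G 1 (initial_belief G y))"

lemma belief_strategy_expected_cost_le:
  assumes "minmax_selector G \<Xi>" "g2 \<in> strategies2 G"
  shows "expected_cost G (belief_strategy G \<Xi>) g2 \<le> game_value"
  unfolding game_value_def
    expected_cost_by_observation[OF belief_strategy_in_strategies1[OF valid assms(1)] assms(2)]
proof (intro sum_mono mult_left_mono)
  fix y assume "y \<in> observations G 1"
  then show "(\<Sum>x\<in>states G 1. pmf (initial_belief G y) x *
      cost_from G (belief_strategy G \<Xi>) g2 1 x ([y], [])) \<le> upper_value G 1 (initial_belief G y)"
    using belief_strategy_cost_le[OF valid assms, of 1 "([y], [])"] initial_common_info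
      initial_belief_in_beliefs[OF valid] by simp
qed simp

lemma approx_optimal_strategy2:
  assumes sel: "minmax_selector G \<Xi>" and e: "0 < e"
  shows "\<exists>g2\<in>strategies2 G. \<forall>g1\<in>strategies1 G. game_value - e \<le> expected_cost G g1 g2"
proof -
  have "\<exists>\<alpha>. guaranteed G 1 \<alpha> \<and> upper_value G 1 (initial_belief G y) - e \<le>
      (\<Sum>x\<in>states G 1. pmf (initial_belief G y) x * \<alpha> x)" for y
    by (rule upper_value_approx_guaranteed[OF valid sel _ initial_belief_in_beliefs[OF valid] e]) simp
  then obtain \<alpha> where \<alpha>: "\<And>y. guaranteed G 1 (\<alpha> y)"
    "\<And>y. upper_value G 1 (initial_belief G y) - e \<le>
      (\<Sum>x\<in>states G 1. pmf (initial_belief G y) x * \<alpha> y x)"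
    by metis
  obtain g2 where g2: "g2 \<in> strategies2 G" "\<And>g1 x y. g1 \<in> strategies1 G \<Longrightarrow> x \<in> states G 1 \<Longrightarrow>
      y \<in> observations G 1 \<Longrightarrow> \<alpha> y x \<le> cost_from G g1 g2 1 x ([y], [])"
    using strategy2_of_guarantees[of \<alpha>] \<alpha>(1) by blast
  have "game_value - e \<le> expected_cost G g1 g2" if g1: "g1 \<in> strategies1 G" for g1
  proof -
    have "game_value - e = (\<Sum>y\<in>observations G 1. measure_pmf.prob (initial_law G) {(x, y'). y' = y} *
        (upper_value G 1 (initial_belief G y) - e))"
      using sum_prob_observation
      by (simp add: game_value_def right_diff_distrib sum_subtractf flip: sum_distrib_right)
    also have "\<dots> \<le> expected_cost G g1 g2"
      unfolding expected_cost_by_observation[OF g1 g2(1)]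
    proof (intro sum_mono mult_left_mono)
      fix y assume "y \<in> observations G 1"
      then show "upper_value G 1 (initial_belief G y) - e \<le>
          (\<Sum>x\<in>states G 1. pmf (initial_belief G y) x * cost_from G g1 g2 1 x ([y], []))"
        using g2(2)[OF g1] by (intro order_trans[OF \<alpha>(2)] average_mono)
    qed simp
    finally show ?thesis .
  qed
  then show ?thesis using g2(1) by blast
qed

text \<open>Each near-optimal strategy works against all \<open>g1\<close> simultaneously, so the
  subsequence and its limit are chosen before \<open>g1\<close>, and the limiting inequality holds
  for every \<open>g1\<close>.\<close>

lemma optimal_strategy2:
  assumes sel: "minmax_selector G \<Xi>"
  shows "\<exists>g2\<in>strategies2 G. \<forall>g1\<in>strategies1 G. game_value \<le> expected_cost G g1 g2"
proof -
  have "\<exists>g2\<in>strategies2 G. \<forall>g1\<in>strategies1 G.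
      game_value - inverse (real (Suc n)) \<le> expected_cost G g1 g2" for n
    by (rule approx_optimal_strategy2[OF sel]) simp
  then obtain s where s: "\<And>n. s n \<in> strategies2 G" "\<And>n g1. g1 \<in> strategies1 G \<Longrightarrow>
      game_value - inverse (real (Suc n)) \<le> expected_cost G g1 (s n)"
    by metis
  obtain r g where r: "strict_mono (r :: nat \<Rightarrow> nat)" and g: "g \<in> strategies2 G"
    and lim: "\<And>t c u. t \<in> {1..horizon G} \<Longrightarrow> c \<in> common_infos G t \<Longrightarrow> u \<in> actions2 G t \<Longrightarrow>
       (\<lambda>n. pmf (s (r n) t c) u) \<longlonglongrightarrow> pmf (g t c) u"
    using strategies2_compact[of s] s(1) by blast
  have "game_value \<le> expected_cost G g1 g" if g1: "g1 \<in> strategies1 G" for g1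
  proof (rule LIMSEQ_le)
    show "(\<lambda>n. expected_cost G g1 (s (r n))) \<longlonglongrightarrow> expected_cost G g1 g"
      unfolding expected_cost_eq[OF valid g1 s(1)] expected_cost_eq[OF valid g1 g] case_prod_unfold
      by (intro tendsto_sum tendsto_mult tendsto_const cost_from_tendsto lim initial_common_info) auto
    have "(\<lambda>n. game_value - inverse (real (Suc n))) \<longlonglongrightarrow> game_value - 0"
      by (intro tendsto_diff tendsto_const LIMSEQ_inverse_real_of_nat)
    from LIMSEQ_subseq_LIMSEQ[OF this r]
    show "(\<lambda>n. game_value - inverse (real (Suc (r n)))) \<longlonglongrightarrow> game_value" by (simp add: o_def)
    show "\<exists>N. \<forall>n\<ge>N. game_value - inverse (real (Suc (r n))) \<le> expected_cost G g1 (s (r n))"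
      using s(2)[OF g1] by blast
  qed
  then show ?thesis using g by blast
qed

end

theorem theorem3:
  fixes G :: "('x, 'u1, 'u2, 'y, 'ws, 'w2) game"
    and \<Xi> :: "nat \<Rightarrow> 'x pmf \<Rightarrow> 'x \<Rightarrow> 'u1 pmf"
  assumes "valid_game G"
    and "minmax_selector G \<Xi>"
  shows "(SUP g2\<in>strategies2 G. expected_cost G (belief_strategy G \<Xi>) g2)
           = (INF g1\<in>strategies1 G. SUP g2\<in>strategies2 G. expected_cost G g1 g2)
         \<and> (\<exists>g2. nash_equilibrium G (belief_strategy G \<Xi>) g2)"
proof -
  let ?J = "expected_cost G" and ?g1 = "belief_strategy G \<Xi>" and ?v = "game_value G"
  have g1: "?g1 \<in> strategies1 G"
    by (rule belief_strategy_in_strategies1[OF assms])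
  note upper = belief_strategy_expected_cost_le[OF assms]
  obtain g2 where g2: "g2 \<in> strategies2 G" and lower: "\<And>g1. g1 \<in> strategies1 G \<Longrightarrow> ?v \<le> ?J g1 g2"
    using optimal_strategy2[OF assms] by blast
  \<comment> \<open>The two one-sided bounds meet at this pair, which is therefore a saddle
    point.\<close>
  have eq: "?J ?g1 g2 = ?v"
    by (rule antisym[OF upper[OF g2] lower[OF g1]])
  have sup: "(SUP g2\<in>strategies2 G. ?J ?g1 g2) = ?v"
    using upper g2 eq by (intro cSup_eq_maximum) (auto intro: image_eqI[OF _ g2])
  obtain B where B: "\<And>g1 g2. g1 \<in> strategies1 G \<Longrightarrow> g2 \<in> strategies2 G \<Longrightarrow> \<bar>?J g1 g2\<bar> \<le> B"
    using expected_cost_bounded[OF assms(1)] by blast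
  have "?v \<le> (SUP g2\<in>strategies2 G. ?J g1 g2)" if "g1 \<in> strategies1 G" for g1
  proof (intro cSUP_upper2[where x = g2] g2 lower that)
    show "bdd_above (?J g1 ` strategies2 G)"
      using B[OF that] by (intro bdd_aboveI2[where M = B]) (simp add: abs_le_iff)
  qed
  then have "(INF g1\<in>strategies1 G. SUP g2\<in>strategies2 G. ?J g1 g2) = ?v"
    using sup g1 by (intro cInf_eq_minimum) (auto intro: image_eqI[OF _ g1])
  moreover have "nash_equilibrium G ?g1 g2"
    using g1 g2 upper lower eq by (simp add: nash_equilibrium_def)
  ultimately show ?thesis using sup by auto
qed

end
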